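(* Let $X$ be one of the spaces $\mathrm{(cfid)}$, $\mathrm{(pfd)}$, $\mathrm{(rid)}$ with the topology induced by the interleaving distance. The path component of the zero module in $X$ consists of the modules $M\cong\bigoplus_{\alpha\in A}I_\alpha$ in $X$ (with each $I_\alpha$ an interval module) such that $\sup_{\alpha\in A}\operatorname{length}(I_\alpha)<\infty$.
   Context: Fix a field $\mathbf{k}$. A persistence module is a functor $M:(\mathbb{R},\le)\to \mathrm{Vect}_{\mathbf{k}}$; "persistence module" means isomorphism class. For an interval $J\subset\mathbb{R}$, the interval module $J$ is $\mathbf{k}$ at points of $J$ and $0$ elsewhere, with identity maps between points of $J$ and zero maps otherwise. For $\varepsilon\ge 0$, $M,N$ are $\varepsilon$-interleaved if there are families of linear maps $\varphi_a:M(a)\to N(a+\varepsilon)$ and $\psi_a:N(a)\to M(a+\varepsilon)$, natural in $a\in\mathbb{R}$, with $\psi_{a+\varepsilon}\varphi_a=M(a\le a+2\varepsilon)$ and $\varphi_{a+\varepsilon}\psi_a=N(a\le a+2\varepsilon)$ for all $a$. The interleaving distance is $d_I(M,N)=\inf\{\varepsilon\ge0 : M,N \text{ are } \varepsilon\text{-interleaved}\}$ ($\infty$ if there is none). It is an extended pseudometric; the induced topology has the open balls $B_r(M)=\{N: d_I(M,N)<r\}$, $r>0$, as a base. $\mathrm{(cfid)}$: direct sums of countably many interval modules with all intervals finite (bounded); $\mathrm{(pfd)}$: persistence modules $M$ with every $M(a)$ finite dimensional (every such $M$ is isomorphic to a direct sum of interval modules, by Crawley-Boevey's theorem); $\mathrm{(rid)}$: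 direct sums $\bigoplus_{\alpha\in A}I_\alpha$ of interval modules with $|A|\le|\mathbb{R}|$. The length of an interval $I$ is $\sup I-\inf I\in[0,\infty]$. *)

theory Defs
  imports "HOL-Analysis.Analysis" "HOL-Library.Function_Algebras"
begin

text \<open>
  All vector spaces occurring below are subspaces of the ambient vector space of functions
  from the reals to the field \<open>'k\<close>.  Its dimension is at least the cardinality of the
  continuum, so every module in the three spaces under consideration has an isomorphic copy
  of this form, and passing to isomorphism classes makes the choice of copy irrelevant.
\<close>

definition vscale :: "'k::field \<Rightarrow> (real \<Rightarrow> 'k) \<Rightarrow> real \<Rightarrow> 'k" where
  "vscale c v = (\<lambda>\<alpha>. c * v \<alpha>)"

global_interpretation vec: vector_space "vscale :: 'k::field \<Rightarrow> (real \<Rightarrow> 'k) \<Rightarrow> real \<Rightarrow> 'k"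
  by unfold_locales (auto simp: vscale_def fun_eq_iff algebra_simps)

definition linear_between ::
  "(real \<Rightarrow> 'k::field) set \<Rightarrow> (real \<Rightarrow> 'k) set \<Rightarrow> ((real \<Rightarrow> 'k) \<Rightarrow> real \<Rightarrow> 'k) \<Rightarrow> bool" where
  "linear_between U V f \<longleftrightarrow>
     f \<in> U \<rightarrow> V \<and>
     (\<forall>u\<in>U. \<forall>v\<in>U. f (u + v) = f u + f v) \<and>
     (\<forall>c. \<forall>u\<in>U. f (vscale c u) = vscale c (f u))"

text \<open>
  The values \<open>pm_map M a b\<close> are relevant only for \<open>a \<le> b\<close> and only on \<open>pm_space M a\<close>;
  \<open>isomorphic\<close> and \<open>interleaved\<close> do not look at them elsewhere.
\<close>

record 'k pmod =
  pm_space :: "real \<Rightarrow> (real \<Rightarrow> 'k) set"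
  pm_map :: "real \<Rightarrow> real \<Rightarrow> (real \<Rightarrow> 'k) \<Rightarrow> real \<Rightarrow> 'k"

definition persistence_module :: "'k::field pmod \<Rightarrow> bool" where
  "persistence_module M \<longleftrightarrow>
     (\<forall>a. vec.subspace (pm_space M a)) \<and>
     (\<forall>a b. a \<le> b \<longrightarrow> linear_between (pm_space M a) (pm_space M b) (pm_map M a b)) \<and>
     (\<forall>a. \<forall>x\<in>pm_space M a. pm_map M a a x = x) \<and>
     (\<forall>a b c. a \<le> b \<longrightarrow> b \<le> c \<longrightarrow>
        (\<forall>x\<in>pm_space M a. pm_map M b c (pm_map M a b x) = pm_map M a c x))"

definition isomorphic :: "'k::field pmod \<Rightarrow> 'k pmod \<Rightarrow> bool" where
  "isomorphic M N \<longleftrightarrow>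
     (\<exists>\<theta>. (\<forall>a. linear_between (pm_space M a) (pm_space N a) (\<theta> a) \<and>
              bij_betw (\<theta> a) (pm_space M a) (pm_space N a)) \<and>
          (\<forall>a b. a \<le> b \<longrightarrow>
             (\<forall>x\<in>pm_space M a. \<theta> b (pm_map M a b x) = pm_map N a b (\<theta> a x))))"

definition iso_class :: "'k::field pmod \<Rightarrow> 'k pmod set" where
  "iso_class M = {N. persistence_module N \<and> isomorphic M N}"

definition zero_module :: "'k::field pmod" where
  "zero_module = \<lparr>pm_space = (\<lambda>a. {0}), pm_map = (\<lambda>a b x. 0)\<rparr>"


definition interval :: "real set \<Rightarrow> bool" where
  "interval J \<longleftrightarrow> is_interval J \<and> J \<noteq> {}"

definition interval_space :: "real set \<Rightarrow> real \<Rightarrow> 'k::field set" where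
  "interval_space J a = (if a \<in> J then UNIV else {0})"

definition interval_map :: "real set \<Rightarrow> real \<Rightarrow> real \<Rightarrow> 'k::field \<Rightarrow> 'k" where
  "interval_map J a b x = (if a \<in> J \<and> b \<in> J then x else 0)"

text \<open>
  The direct sum of the interval modules \<open>I \<alpha>\<close> over \<open>\<alpha> \<in> A\<close>: finitely supported families
  with componentwise maps.  Index sets are sets of reals, that is, up to
  reindexing, arbitrary sets of at most continuum cardinality.
\<close>

definition interval_sum :: "real set \<Rightarrow> (real \<Rightarrow> real set) \<Rightarrow> 'k::field pmod" where
  "interval_sum A I =
     \<lparr>pm_space = (\<lambda>a. {v. finite {\<alpha>. v \<alpha> \<noteq> 0} \<and>
                         (\<forall>\<alpha>\<in>A. v \<alpha> \<in> interval_space (I \<alpha>) a) \<and> (\<forall>\<alpha>. \<alpha> \<notin> A \<longrightarrow> v \<alpha> = 0)}),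
      pm_map = (\<lambda>a b v \<alpha>. interval_map (I \<alpha>) a b (v \<alpha>))\<rparr>"

definition interval_length :: "real set \<Rightarrow> ereal" where
  "interval_length J = Sup (ereal ` J) - Inf (ereal ` J)"


definition interleaved :: "real \<Rightarrow> 'k::field pmod \<Rightarrow> 'k pmod \<Rightarrow> bool" where
  "interleaved \<epsilon> M N \<longleftrightarrow>
     (\<exists>\<phi> \<psi>.
        (\<forall>a. linear_between (pm_space M a) (pm_space N (a + \<epsilon>)) (\<phi> a)) \<and>
        (\<forall>a. linear_between (pm_space N a) (pm_space M (a + \<epsilon>)) (\<psi> a)) \<and>
        (\<forall>a b. a \<le> b \<longrightarrow> (\<forall>x\<in>pm_space M a.
           \<phi> b (pm_map M a b x) = pm_map N (a + \<epsilon>) (b + \<epsilon>) (\<phi> a x))) \<and>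
        (\<forall>a b. a \<le> b \<longrightarrow> (\<forall>x\<in>pm_space N a.
           \<psi> b (pm_map N a b x) = pm_map M (a + \<epsilon>) (b + \<epsilon>) (\<psi> a x))) \<and>
        (\<forall>a. \<forall>x\<in>pm_space M a. \<psi> (a + \<epsilon>) (\<phi> a x) = pm_map M a (a + 2 * \<epsilon>) x) \<and>
        (\<forall>a. \<forall>x\<in>pm_space N a. \<phi> (a + \<epsilon>) (\<psi> a x) = pm_map N a (a + 2 * \<epsilon>) x))"

definition interleaving_distance :: "'k::field pmod \<Rightarrow> 'k pmod \<Rightarrow> ereal" where
  "interleaving_distance M N = Inf {ereal \<epsilon> | \<epsilon>. 0 \<le> \<epsilon> \<and> interleaved \<epsilon> M N}"

definition cfid :: "'k::field pmod set" where
  "cfid = {M. persistence_module M \<and>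
     (\<exists>A I. countable A \<and> (\<forall>\<alpha>\<in>A. interval (I \<alpha>) \<and> bounded (I \<alpha>)) \<and>
            isomorphic M (interval_sum A I))}"

definition pfd :: "'k::field pmod set" where
  "pfd = {M. persistence_module M \<and>
     (\<forall>a. \<exists>B. finite B \<and> vec.span B = pm_space M a)}"

definition rid :: "'k::field pmod set" where
  "rid = {M. persistence_module M \<and>
     (\<exists>A I. (\<forall>\<alpha>\<in>A. interval (I \<alpha>)) \<and> isomorphic M (interval_sum A I))}"

text \<open>
  For an isomorphism-closed set \<open>X\<close> of persistence modules, the points of the associated space
  are the isomorphism classes of the members of \<open>X\<close>.  The distance is invariant under
  isomorphism, so balls are independent of representatives; by the triangle inequality they
  form a base of the topology they generate.
\<close>

definition interleaving_ball :: "'k::field pmod set \<Rightarrow> 'k pmod \<Rightarrow> real \<Rightarrow> 'k pmod set set" where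
  "interleaving_ball X M r =
     iso_class ` {N \<in> X. interleaving_distance M N < ereal r}"

definition interleaving_topology :: "'k::field pmod set \<Rightarrow> 'k pmod set topology" where
  "interleaving_topology X =
     topology_generated_by {interleaving_ball X M r | M r. M \<in> X \<and> 0 < r}"

end

theory Submission
  imports Defs
begin

text \<open>
  Both inclusions rest on the long structure maps.  If \<open>M\<close> is \<open>\<epsilon>\<close>-interleaved with the zero module,
  then every map \<open>M(a \<le> a + 2\<epsilon>)\<close> factors through \<open>0\<close>, so no interval of a decomposition of \<open>M\<close>
  is longer than \<open>2\<epsilon>\<close>.  Modules at finite distance from the zero module form an open and closed
  set by the triangle inequality, hence contain its path component
  (\<open>path_component_imp_interleaved\<close>).  Conversely, cutting a piece of length \<open>t\<close> off the right end
  of every interval moves a direct sum of intervals by at most \<open>t\<close>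
  (\<open>shrink_interleaved\<close>); if the lengths are bounded, then letting \<open>t\<close> grow gives a path that
  reaches the zero module after finite time.

  For pointwise finite-dimensional modules the first inclusion also needs the existence of a
  decomposition into intervals, Crawley-Boevey's theorem (\<open>pfd_interval_decomposition\<close>).  Its core
  is that a nonzero module \<open>M\<close> has an interval module as a direct summand (\<open>exists_split_bar\<close>).
  If \<open>M(a) \<noteq> 0\<close>, take a vector \<open>z \<noteq> 0\<close> in the smallest nonzero kernel of the maps
  \<open>M(a \<le> u)\<close>, or any \<open>z \<noteq> 0\<close> if they are all injective: as long as \<open>z\<close> survives, \<open>M(a \<le> u)\<close> is
  injective.  Downwards, \<open>z\<close> lifts to a compatible family over all parameters whose image contains
  it, because images stabilise in finite dimension (\<open>section_through_images\<close>).  A maximal submodule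
  avoiding the resulting family is a complement of it (\<open>bar_complement\<close>).  Zorn's lemma, applied to
  sets of summands together with a complement of their sum, then decomposes \<open>M\<close> completely, because
  along a chain the complements stabilise at each parameter (\<open>decomposition_limit\<close>,
  \<open>bar_decomposition\<close>).
\<close>

section \<open>Linear maps and finite-dimensional subspaces\<close>

lemma linear_between_mem: "linear_between U V f \<Longrightarrow> u \<in> U \<Longrightarrow> f u \<in> V"
  by (auto simp: linear_between_def)

lemma linear_between_add:
  "linear_between U V f \<Longrightarrow> u \<in> U \<Longrightarrow> v \<in> U \<Longrightarrow> f (u + v) = f u + f v"
  by (auto simp: linear_between_def)

lemma linear_between_scale:
  "linear_between U V f \<Longrightarrow> u \<in> U \<Longrightarrow> f (vscale c u) = vscale c (f u)"
  by (auto simp: linear_between_def)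

lemma linear_between_zero:
  assumes "linear_between U V f" "vec.subspace U"
  shows "f 0 = 0"
  using linear_between_scale[OF assms(1) vec.subspace_0[OF assms(2)], of 0] by simp

lemma linear_between_diff:
  assumes f: "linear_between U V f" and U: "vec.subspace U" and "u \<in> U" "v \<in> U"
  shows "f (u - v) = f u - f v"
proof -
  have "u = (u - v) + v" by simp
  then have "f u = f (u - v) + f v"
    using linear_between_add[OF f vec.subspace_diff[OF U assms(3,4)] assms(4)] by simp
  then show ?thesis by simp
qed

lemma linear_between_sum:
  assumes f: "linear_between U V f" and U: "vec.subspace U" and g: "\<And>i. i \<in> A \<Longrightarrow> g i \<in> U"
  shows "f (\<Sum>i\<in>A. g i) = (\<Sum>i\<in>A. f (g i))"
  using g
proof (induction A rule: infinite_finite_induct)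
  case (insert i A)
  then have "f (g i + (\<Sum>i\<in>A. g i)) = f (g i) + f (\<Sum>i\<in>A. g i)"
    by (intro linear_between_add[OF f] vec.subspace_sum[OF U]) auto
  with insert show ?case by (simp only: sum.insert insert_iff simp_thms)
qed (use linear_between_zero[OF f U] in auto)

lemma linear_between_compose:
  "linear_between U V f \<Longrightarrow> linear_between V W g \<Longrightarrow> linear_between U W (\<lambda>x. g (f x))"
  by (auto simp: linear_between_def Pi_def)

lemma linear_between_restrict:
  "linear_between U V f \<Longrightarrow> U' \<subseteq> U \<Longrightarrow> (\<And>u. u \<in> U' \<Longrightarrow> f u \<in> V') \<Longrightarrow> linear_between U' V' f"
  unfolding linear_between_def by blast

lemma subspace_linear_image:
  assumes f: "linear_between U V f" and U: "vec.subspace U"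
  shows "vec.subspace (f ` U)"
  unfolding vec.subspace_def
proof (intro conjI ballI allI)
  show "0 \<in> f ` U"
    using linear_between_zero[OF f U] vec.subspace_0[OF U] by force
  show "x + y \<in> f ` U" if "x \<in> f ` U" "y \<in> f ` U" for x y
    using that linear_between_add[OF f] vec.subspace_add[OF U] by (auto simp flip: linear_between_add[OF f])
  show "vscale c x \<in> f ` U" if "x \<in> f ` U" for c x
    using that vec.subspace_scale[OF U] by (auto simp flip: linear_between_scale[OF f])
qed

definition finite_dim :: "(real \<Rightarrow> 'k::field) set \<Rightarrow> bool" where
  "finite_dim W \<longleftrightarrow> (\<exists>B. finite B \<and> W \<subseteq> vec.span B)"

lemma finite_dim_subset: "finite_dim W \<Longrightarrow> U \<subseteq> W \<Longrightarrow> finite_dim U"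
  by (auto simp: finite_dim_def)

lemma finite_dim_spanned_exactly:
  assumes "finite_dim W" "vec.subspace W"
  obtains B where "finite B" "vec.span B = W"
proof -
  obtain T where T: "finite T" "W \<subseteq> vec.span T"
    using assms(1) by (auto simp: finite_dim_def)
  obtain B where B: "B \<subseteq> W" "vec.independent B" "W \<subseteq> vec.span B"
    by (rule vec.basis_exists)
  have "finite B"
    using vec.independent_span_bound[OF T(1) B(2)] B(1) T(2) by blast
  moreover have "vec.span B = W"
    using B vec.span_minimal[OF B(1) assms(2)] by blast
  ultimately show thesis by (rule that)
qed

lemma finite_dim_linear_image:
  assumes "finite_dim U" "vec.subspace U" and f: "linear_between U V f"
  shows "finite_dim (f ` U)"
proof -
  obtain B where B: "finite B" "vec.span B = U"
    by (rule finite_dim_spanned_exactly[OF assms(1,2)])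
  have "f u \<in> vec.span (f ` B)" if "u \<in> U" for u
  proof -
    obtain c where c: "u = (\<Sum>b\<in>B. vscale (c b) b)"
      using \<open>u \<in> U\<close> B by (auto simp: vec.span_finite)
    have BU: "b \<in> U" if "b \<in> B" for b
      using B that vec.span_base by auto
    have "f u = (\<Sum>b\<in>B. f (vscale (c b) b))"
      unfolding c by (intro linear_between_sum[OF f assms(2)] vec.subspace_scale[OF assms(2)] BU)
    also have "\<dots> = (\<Sum>b\<in>B. vscale (c b) (f b))"
      by (intro sum.cong refl linear_between_scale[OF f] BU)
    also have "\<dots> \<in> vec.span (f ` B)"
      by (intro vec.span_sum vec.span_scale vec.span_base imageI)
    finally show ?thesis .
  qed
  with B(1) show ?thesis unfolding finite_dim_def by blast
qed

lemma subspace_eq_of_dim_le: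
  assumes "finite_dim W" "vec.subspace U" "vec.subspace W" "U \<subseteq> W" "vec.dim W \<le> vec.dim U"
  shows "U = W"
proof -
  obtain T where T: "finite T" "W \<subseteq> vec.span T"
    using assms(1) by (auto simp: finite_dim_def)
  obtain B where B: "B \<subseteq> U" "vec.independent B" "U \<subseteq> vec.span B" "card B = vec.dim U"
    by (rule vec.basis_exists)
  obtain B' where B': "B \<subseteq> B'" "B' \<subseteq> W" "vec.independent B'" "W \<subseteq> vec.span B'"
    by (rule vec.maximal_independent_subset_extend[of B W]) (use B assms(4) in blast)+
  have "finite B'"
    using vec.independent_span_bound[OF T(1) B'(3)] B'(2) T(2) by blast
  moreover have "card B' = vec.dim W"
    using vec.basis_card_eq_dim B' by blast
  ultimately have "B = B'"
    using B' B(4) assms(5) by (metis card_seteq)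
  then show ?thesis
    using B' B(1) assms(4) vec.span_minimal[OF B(1) assms(2)] by blast
qed

text \<open>
  A chain member of least dimension lies in all others.  Through this fact finite dimension
  makes images, kernels and complements stabilise.
\<close>

lemma chain_of_subspaces_has_least:
  assumes "\<F> \<noteq> {}" and sub: "\<And>U. U \<in> \<F> \<Longrightarrow> vec.subspace U \<and> finite_dim U"
    and chain: "\<And>U V. U \<in> \<F> \<Longrightarrow> V \<in> \<F> \<Longrightarrow> U \<subseteq> V \<or> V \<subseteq> U"
  obtains U where "U \<in> \<F>" "\<And>V. V \<in> \<F> \<Longrightarrow> U \<subseteq> V"
proof -
  obtain U where U: "U \<in> \<F>" "\<And>V. V \<in> \<F> \<Longrightarrow> vec.dim U \<le> vec.dim V"
    using assms(1) ex_has_least_nat[of "\<lambda>U. U \<in> \<F>" _ vec.dim] by fast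
  have "U \<subseteq> V" if V: "V \<in> \<F>" for V
    using chain[OF U(1) V] subspace_eq_of_dim_le[of U V] U sub V by blast
  with U(1) show thesis by (rule that)
qed

section \<open>Persistence modules up to isomorphism and interleaving\<close>

lemma pm_subspace: "persistence_module M \<Longrightarrow> vec.subspace (pm_space M a)"
  by (auto simp: persistence_module_def)

lemma pm_linear:
  "persistence_module M \<Longrightarrow> a \<le> b \<Longrightarrow> linear_between (pm_space M a) (pm_space M b) (pm_map M a b)"
  by (auto simp: persistence_module_def)

lemma pm_id: "persistence_module M \<Longrightarrow> x \<in> pm_space M a \<Longrightarrow> pm_map M a a x = x"
  by (auto simp: persistence_module_def)

lemma pm_comp:
  "persistence_module M \<Longrightarrow> a \<le> b \<Longrightarrow> b \<le> c \<Longrightarrow> x \<in> pm_space M a \<Longrightarrow>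
     pm_map M b c (pm_map M a b x) = pm_map M a c x"
  by (auto simp: persistence_module_def)

lemma pm_mem:
  "persistence_module M \<Longrightarrow> a \<le> b \<Longrightarrow> x \<in> pm_space M a \<Longrightarrow> pm_map M a b x \<in> pm_space M b"
  using pm_linear linear_between_mem by blast

lemma pm_zero: "persistence_module M \<Longrightarrow> a \<le> b \<Longrightarrow> pm_map M a b 0 = 0"
  using pm_linear linear_between_zero pm_subspace by blast

lemma pm_add: "persistence_module M \<Longrightarrow> s \<le> t \<Longrightarrow> u \<in> pm_space M s \<Longrightarrow> v \<in> pm_space M s \<Longrightarrow>
    pm_map M s t (u + v) = pm_map M s t u + pm_map M s t v"
  using linear_between_add[OF pm_linear] .

lemma pm_diff: "persistence_module M \<Longrightarrow> s \<le> t \<Longrightarrow> u \<in> pm_space M s \<Longrightarrow> v \<in> pm_space M s \<Longrightarrow>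
    pm_map M s t (u - v) = pm_map M s t u - pm_map M s t v"
  using linear_between_diff[OF pm_linear pm_subspace] .

lemma pm_scale: "persistence_module M \<Longrightarrow> s \<le> t \<Longrightarrow> u \<in> pm_space M s \<Longrightarrow>
    pm_map M s t (vscale c u) = vscale c (pm_map M s t u)"
  using linear_between_scale[OF pm_linear] .

text \<open>
  Treating ordinary morphisms as the case \<open>\<epsilon> = 0\<close> lets isomorphisms and interleavings share
  one composition lemma.
\<close>

definition shift_morphism ::
  "real \<Rightarrow> 'k::field pmod \<Rightarrow> 'k pmod \<Rightarrow> (real \<Rightarrow> (real \<Rightarrow> 'k) \<Rightarrow> real \<Rightarrow> 'k) \<Rightarrow> bool" where
  "shift_morphism \<epsilon> M N \<phi> \<longleftrightarrow>
     (\<forall>a. linear_between (pm_space M a) (pm_space N (a + \<epsilon>)) (\<phi> a)) \<and>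
     (\<forall>a b. a \<le> b \<longrightarrow> (\<forall>x\<in>pm_space M a.
        \<phi> b (pm_map M a b x) = pm_map N (a + \<epsilon>) (b + \<epsilon>) (\<phi> a x)))"

lemma shift_morphism_linear:
  "shift_morphism \<epsilon> M N \<phi> \<Longrightarrow> linear_between (pm_space M a) (pm_space N (a + \<epsilon>)) (\<phi> a)"
  by (simp add: shift_morphism_def)

lemma shift_morphism_natural:
  "shift_morphism \<epsilon> M N \<phi> \<Longrightarrow> a \<le> b \<Longrightarrow> x \<in> pm_space M a \<Longrightarrow>
     \<phi> b (pm_map M a b x) = pm_map N (a + \<epsilon>) (b + \<epsilon>) (\<phi> a x)"
  by (simp add: shift_morphism_def)

lemma shift_morphism_mem:
  "shift_morphism \<epsilon> M N \<phi> \<Longrightarrow> x \<in> pm_space M a \<Longrightarrow> \<phi> a x \<in> pm_space N (a + \<epsilon>)"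
  using shift_morphism_linear linear_between_mem by blast

lemma shift_morphism_compose:
  assumes \<phi>: "shift_morphism \<epsilon> M N \<phi>" and \<psi>: "shift_morphism \<delta> N P \<psi>"
  shows "shift_morphism (\<epsilon> + \<delta>) M P (\<lambda>a x. \<psi> (a + \<epsilon>) (\<phi> a x))"
proof -
  have as: "a + (\<epsilon> + \<delta>) = a + \<epsilon> + \<delta>" for a by simp
  have "linear_between (pm_space M a) (pm_space P (a + (\<epsilon> + \<delta>))) (\<lambda>x. \<psi> (a + \<epsilon>) (\<phi> a x))" for a
    unfolding as using shift_morphism_linear[OF \<phi>] shift_morphism_linear[OF \<psi>]
    by (rule linear_between_compose)
  moreover have "\<psi> (b + \<epsilon>) (\<phi> b (pm_map M a b x)) =
      pm_map P (a + (\<epsilon> + \<delta>)) (b + (\<epsilon> + \<delta>)) (\<psi> (a + \<epsilon>) (\<phi> a x))"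
    if "a \<le> b" "x \<in> pm_space M a" for a b x
    unfolding as using that shift_morphism_mem[OF \<phi>]
    by (simp add: shift_morphism_natural[OF \<phi>] shift_morphism_natural[OF \<psi>])
  ultimately show ?thesis by (simp add: shift_morphism_def)
qed

lemma isomorphic_iff:
  "isomorphic M N \<longleftrightarrow>
     (\<exists>\<theta>. shift_morphism 0 M N \<theta> \<and> (\<forall>a. bij_betw (\<theta> a) (pm_space M a) (pm_space N a)))"
  unfolding isomorphic_def shift_morphism_def by (simp add: all_conj_distrib conj_ac)

lemma isomorphic_refl: "isomorphic M M"
  unfolding isomorphic_iff
  by (intro exI[of _ "\<lambda>a x. x"]) (auto simp: shift_morphism_def linear_between_def bij_betw_def)

lemma inverse_of_isomorphism:
  assumes M: "persistence_module M" and \<theta>: "shift_morphism 0 M N \<theta>"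
    and bij: "\<And>a. bij_betw (\<theta> a) (pm_space M a) (pm_space N a)"
  defines "\<eta> \<equiv> \<lambda>a. inv_into (pm_space M a) (\<theta> a)"
  shows "shift_morphism 0 N M \<eta>"
proof -
  have \<theta>\<eta>: "\<theta> a (\<eta> a y) = y" "\<eta> a y \<in> pm_space M a" if "y \<in> pm_space N a" for a y
    using that bij_betw_inv_into_right[OF bij] bij_betwE[OF bij_betw_inv_into[OF bij]]
    by (auto simp: \<eta>_def)
  have \<eta>eq: "\<eta> a y = x" if "x \<in> pm_space M a" "\<theta> a x = y" for a x y
    using that bij_betw_inv_into_left[OF bij] by (auto simp: \<eta>_def)
  have lin: "linear_between (pm_space M a) (pm_space N a) (\<theta> a)" for a
    using shift_morphism_linear[OF \<theta>, of a] by simp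
  have "linear_between (pm_space N a) (pm_space M a) (\<eta> a)" for a
    unfolding linear_between_def
  proof (intro conjI ballI allI)
    show "\<eta> a \<in> pm_space N a \<rightarrow> pm_space M a" using \<theta>\<eta> by blast
    show "\<eta> a (u + v) = \<eta> a u + \<eta> a v" if "u \<in> pm_space N a" "v \<in> pm_space N a" for u v
      using that by (intro \<eta>eq) (simp_all add: \<theta>\<eta> linear_between_add[OF lin]
          vec.subspace_add[OF pm_subspace[OF M]])
    show "\<eta> a (vscale c u) = vscale c (\<eta> a u)" if "u \<in> pm_space N a" for c u
      using that by (intro \<eta>eq) (simp_all add: \<theta>\<eta> linear_between_scale[OF lin]
          vec.subspace_scale[OF pm_subspace[OF M]])
  qed
  moreover have "\<eta> b (pm_map N a b y) = pm_map M a b (\<eta> a y)" if "a \<le> b" "y \<in> pm_space N a" for a b y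
    using that shift_morphism_natural[OF \<theta>, of a b "\<eta> a y"]
    by (intro \<eta>eq) (simp_all add: \<theta>\<eta> pm_mem[OF M])
  ultimately show ?thesis by (simp add: shift_morphism_def)
qed

lemma isomorphic_sym:
  assumes M: "persistence_module M" and "isomorphic M N"
  shows "isomorphic N M"
proof -
  obtain \<theta> where "shift_morphism 0 M N \<theta>" "\<And>a. bij_betw (\<theta> a) (pm_space M a) (pm_space N a)"
    using assms(2) unfolding isomorphic_iff by blast
  then show ?thesis
    unfolding isomorphic_iff
    using inverse_of_isomorphism[OF M] bij_betw_inv_into by blast
qed

lemma isomorphic_trans:
  assumes "isomorphic M N" "isomorphic N P"
  shows "isomorphic M P"
proof -
  obtain \<theta> where \<theta>: "shift_morphism 0 M N \<theta>" "\<And>a. bij_betw (\<theta> a) (pm_space M a) (pm_space N a)"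
    using assms(1) unfolding isomorphic_iff by blast
  obtain \<eta> where \<eta>: "shift_morphism 0 N P \<eta>" "\<And>a. bij_betw (\<eta> a) (pm_space N a) (pm_space P a)"
    using assms(2) unfolding isomorphic_iff by blast
  have "shift_morphism 0 M P (\<lambda>a x. \<eta> a (\<theta> a x))"
    using shift_morphism_compose[OF \<theta>(1) \<eta>(1)] by simp
  moreover have "bij_betw (\<lambda>x. \<eta> a (\<theta> a x)) (pm_space M a) (pm_space P a)" for a
    using bij_betw_trans[OF \<theta>(2) \<eta>(2)] by (simp add: comp_def)
  ultimately show ?thesis unfolding isomorphic_iff by blast
qed

lemma iso_class_eq_iff:
  assumes "persistence_module M" "persistence_module N"
  shows "iso_class M = iso_class N \<longleftrightarrow> isomorphic M N"
proof
  assume "iso_class M = iso_class N"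
  moreover have "N \<in> iso_class N" using assms isomorphic_refl by (simp add: iso_class_def)
  ultimately show "isomorphic M N" by (auto simp: iso_class_def)
next
  assume "isomorphic M N"
  moreover from this have "isomorphic N M" using assms isomorphic_sym by blast
  ultimately show "iso_class M = iso_class N"
    unfolding iso_class_def using isomorphic_trans by (metis (no_types, lifting))
qed

definition round_trip ::
  "real \<Rightarrow> 'k::field pmod \<Rightarrow> (real \<Rightarrow> (real \<Rightarrow> 'k) \<Rightarrow> real \<Rightarrow> 'k) \<Rightarrow>
     (real \<Rightarrow> (real \<Rightarrow> 'k) \<Rightarrow> real \<Rightarrow> 'k) \<Rightarrow> bool" where
  "round_trip \<epsilon> M \<phi> \<psi> \<longleftrightarrow>
     (\<forall>a. \<forall>x\<in>pm_space M a. \<psi> (a + \<epsilon>) (\<phi> a x) = pm_map M a (a + 2 * \<epsilon>) x)"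

lemma interleaved_iff:
  "interleaved \<epsilon> M N \<longleftrightarrow>
     (\<exists>\<phi> \<psi>. shift_morphism \<epsilon> M N \<phi> \<and> shift_morphism \<epsilon> N M \<psi> \<and>
        round_trip \<epsilon> M \<phi> \<psi> \<and> round_trip \<epsilon> N \<psi> \<phi>)"
  unfolding interleaved_def shift_morphism_def round_trip_def by (simp only: conj_ac)

lemma isomorphic_interleaved:
  assumes M: "persistence_module M" and N: "persistence_module N" and "isomorphic M N"
  shows "interleaved 0 M N"
proof -
  obtain \<theta> where \<theta>: "shift_morphism 0 M N \<theta>" "\<And>a. bij_betw (\<theta> a) (pm_space M a) (pm_space N a)"
    using assms(3) unfolding isomorphic_iff by blast
  define \<eta> where "\<eta> = (\<lambda>a. inv_into (pm_space M a) (\<theta> a))"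
  have "round_trip 0 M \<theta> \<eta>" "round_trip 0 N \<eta> \<theta>"
    using bij_betw_inv_into_left[OF \<theta>(2)] bij_betw_inv_into_right[OF \<theta>(2)] pm_id[OF M] pm_id[OF N]
    by (simp_all add: round_trip_def \<eta>_def)
  moreover have "shift_morphism 0 N M \<eta>"
    unfolding \<eta>_def by (rule inverse_of_isomorphism[OF M \<theta>])
  ultimately show ?thesis unfolding interleaved_iff using \<theta>(1) by blast
qed

lemma interleaved_sym: "interleaved \<epsilon> M N \<Longrightarrow> interleaved \<epsilon> N M"
  unfolding interleaved_iff by blast

text \<open>
  The inner trip is a structure map of \<open>N\<close>; naturality of \<open>\<psi>\<close> carries it over to a structure map
  of \<open>M\<close>, which composes with the one made by the outer trip.
\<close>

lemma round_trip_compose: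
  assumes M: "persistence_module M" and e: "0 \<le> \<epsilon>" "0 \<le> \<delta>"
    and \<phi>: "shift_morphism \<epsilon> M N \<phi>" and \<psi>: "shift_morphism \<epsilon> N M \<psi>"
    and "round_trip \<epsilon> M \<phi> \<psi>" "round_trip \<delta> N \<phi>' \<psi>'"
  shows "round_trip (\<epsilon> + \<delta>) M (\<lambda>a x. \<phi>' (a + \<epsilon>) (\<phi> a x)) (\<lambda>a x. \<psi> (a + \<delta>) (\<psi>' a x))"
  unfolding round_trip_def
proof (intro allI ballI)
  fix a x assume x: "x \<in> pm_space M a"
  have y: "\<phi> a x \<in> pm_space N (a + \<epsilon>)" using shift_morphism_mem[OF \<phi> x] .
  have "\<psi>' (a + (\<epsilon> + \<delta>)) (\<phi>' (a + \<epsilon>) (\<phi> a x)) = pm_map N (a + \<epsilon>) (a + \<epsilon> + 2 * \<delta>) (\<phi> a x)"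
    using assms(7) y by (simp add: round_trip_def add.assoc[symmetric])
  moreover have "a + (\<epsilon> + \<delta>) + \<delta> = a + \<epsilon> + 2 * \<delta>" by simp
  moreover have "\<psi> (a + \<epsilon> + 2 * \<delta>) (pm_map N (a + \<epsilon>) (a + \<epsilon> + 2 * \<delta>) (\<phi> a x))
     = pm_map M (a + \<epsilon> + \<epsilon>) (a + \<epsilon> + 2 * \<delta> + \<epsilon>) (\<psi> (a + \<epsilon>) (\<phi> a x))"
    using shift_morphism_natural[OF \<psi> _ y] e by simp
  moreover have "\<psi> (a + \<epsilon>) (\<phi> a x) = pm_map M a (a + 2 * \<epsilon>) x"
    using assms(6) x by (simp add: round_trip_def)
  moreover have "a + \<epsilon> + \<epsilon> = a + 2 * \<epsilon>" "a + \<epsilon> + 2 * \<delta> + \<epsilon> = a + 2 * (\<epsilon> + \<delta>)" by simp_all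
  moreover have "pm_map M (a + 2 * \<epsilon>) (a + 2 * (\<epsilon> + \<delta>)) (pm_map M a (a + 2 * \<epsilon>) x)
     = pm_map M a (a + 2 * (\<epsilon> + \<delta>)) x"
    using e x by (intro pm_comp[OF M]) auto
  ultimately show "\<psi> (a + (\<epsilon> + \<delta>) + \<delta>) (\<psi>' (a + (\<epsilon> + \<delta>)) (\<phi>' (a + \<epsilon>) (\<phi> a x))) =
      pm_map M a (a + 2 * (\<epsilon> + \<delta>)) x"
    by (simp only:)
qed

lemma interleaved_trans:
  assumes M: "persistence_module M" and P: "persistence_module P"
    and e: "0 \<le> \<epsilon>" "0 \<le> \<delta>"
    and "interleaved \<epsilon> M N" "interleaved \<delta> N P"
  shows "interleaved (\<epsilon> + \<delta>) M P"
proof -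
  obtain \<phi> \<psi> where 1: "shift_morphism \<epsilon> M N \<phi>" "shift_morphism \<epsilon> N M \<psi>"
    "round_trip \<epsilon> M \<phi> \<psi>" "round_trip \<epsilon> N \<psi> \<phi>"
    using assms(5) unfolding interleaved_iff by blast
  obtain \<phi>' \<psi>' where 2: "shift_morphism \<delta> N P \<phi>'" "shift_morphism \<delta> P N \<psi>'"
    "round_trip \<delta> N \<phi>' \<psi>'" "round_trip \<delta> P \<psi>' \<phi>'"
    using assms(6) unfolding interleaved_iff by blast
  show ?thesis
    unfolding interleaved_iff
    using shift_morphism_compose[OF 1(1) 2(1)] shift_morphism_compose[OF 2(2) 1(2)]
      round_trip_compose[OF M e 1(1,2,3) 2(3)] round_trip_compose[OF P e(2,1) 2(2,1,4) 1(4)]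
    by (intro exI[of _ "\<lambda>a x. \<phi>' (a + \<epsilon>) (\<phi> a x)"] exI[of _ "\<lambda>a x. \<psi> (a + \<delta>) (\<psi>' a x)"])
      (simp add: add.commute)
qed

lemma interleaving_distance_less_iff:
  "interleaving_distance M N < ereal r \<longleftrightarrow> (\<exists>\<epsilon>. 0 \<le> \<epsilon> \<and> \<epsilon> < r \<and> interleaved \<epsilon> M N)"
  unfolding interleaving_distance_def Inf_less_iff by auto

section \<open>Splitting off a bar\<close>

text \<open>
  Wherever a bar is nonzero it is carried along by the structure maps, so it spans a copy of
  an interval module; that its support is an interval follows from functoriality.  Before the
  support starts, \<open>x\<close> is zero without constraint, which is why only nonzero values are transported.
\<close>

definition bar :: "'k::field pmod \<Rightarrow> (real \<Rightarrow> real \<Rightarrow> 'k) \<Rightarrow> bool" where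
  "bar M x \<longleftrightarrow> (\<forall>t. x t \<in> pm_space M t) \<and>
     (\<forall>s t. s \<le> t \<longrightarrow> x s \<noteq> 0 \<longrightarrow> pm_map M s t (x s) = x t)"

lemma bar_mem: "bar M x \<Longrightarrow> x t \<in> pm_space M t"
  by (simp add: bar_def)

lemma bar_map: "bar M x \<Longrightarrow> s \<le> t \<Longrightarrow> x s \<noteq> 0 \<Longrightarrow> pm_map M s t (x s) = x t"
  by (simp add: bar_def)

definition submodule :: "'k::field pmod \<Rightarrow> (real \<Rightarrow> (real \<Rightarrow> 'k) set) \<Rightarrow> bool" where
  "submodule M C \<longleftrightarrow> (\<forall>t. vec.subspace (C t) \<and> C t \<subseteq> pm_space M t) \<and>
     (\<forall>s t. s \<le> t \<longrightarrow> (\<forall>z\<in>C s. pm_map M s t z \<in> C t))"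

definition restrict_to :: "'k::field pmod \<Rightarrow> (real \<Rightarrow> (real \<Rightarrow> 'k) set) \<Rightarrow> 'k pmod" where
  "restrict_to M C = \<lparr>pm_space = C, pm_map = pm_map M\<rparr>"

lemma submodule_subspace: "submodule M C \<Longrightarrow> vec.subspace (C t)"
  by (simp add: submodule_def)

lemma submodule_subset: "submodule M C \<Longrightarrow> C t \<subseteq> pm_space M t"
  by (simp add: submodule_def)

lemma submodule_map: "submodule M C \<Longrightarrow> s \<le> t \<Longrightarrow> z \<in> C s \<Longrightarrow> pm_map M s t z \<in> C t"
  by (simp add: submodule_def)

lemma persistence_module_restrict_to:
  assumes M: "persistence_module M" and C: "submodule M C"
  shows "persistence_module (restrict_to M C)"
proof -
  have "linear_between (C a) (C b) (pm_map M a b)" if "a \<le> b" for a b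
    using linear_between_restrict[OF pm_linear[OF M that] submodule_subset[OF C]]
      submodule_map[OF C that] by blast
  moreover have "pm_map M a a x = x" if "x \<in> C a" for a x
    using pm_id[OF M subsetD[OF submodule_subset[OF C] that]] .
  moreover have "pm_map M b c (pm_map M a b x) = pm_map M a c x" if "a \<le> b" "b \<le> c" "x \<in> C a" for a b c x
    using pm_comp[OF M that(1,2) subsetD[OF submodule_subset[OF C] that(3)]] .
  ultimately show ?thesis
    using C by (simp add: persistence_module_def restrict_to_def submodule_def)
qed

text \<open>
  The last two conditions make every \<open>M t\<close> the direct sum of the line through \<open>x t\<close> and \<open>C t\<close>.
\<close>

definition splits :: "'k::field pmod \<Rightarrow> (real \<Rightarrow> real \<Rightarrow> 'k) \<Rightarrow> (real \<Rightarrow> (real \<Rightarrow> 'k) set) \<Rightarrow> bool" where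
  "splits M x C \<longleftrightarrow> bar M x \<and> submodule M C \<and>
     (\<forall>t. x t \<noteq> 0 \<longrightarrow> x t \<notin> C t) \<and> (\<forall>t. \<forall>z\<in>pm_space M t. \<exists>c. z - vscale c (x t) \<in> C t)"

text \<open>
  A sequence is needed for a recursive choice.  Choosing one point of \<open>T\<close> below each rational gives
  a countable coinitial subset, unless \<open>T\<close> has a least element; running minima make it descending.
\<close>

lemma coinitial_sequence:
  fixes T :: "real set"
  assumes "a \<in> T"
  obtains u :: "nat \<Rightarrow> real" where "u 0 = a" "\<And>n. u n \<in> T" "decseq u" "\<And>t. t \<in> T \<Longrightarrow> \<exists>n. u n \<le> t"
proof -
  have "\<exists>w :: nat \<Rightarrow> real. (\<forall>n. w n \<in> T) \<and> (\<forall>t\<in>T. \<exists>n. w n \<le> t)"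
  proof (cases "\<exists>m\<in>T. \<forall>t\<in>T. m \<le> t")
    case True
    then obtain m where "m \<in> T" "\<forall>t\<in>T. m \<le> t" by blast
    then show ?thesis by (intro exI[of _ "\<lambda>n. m"]) simp
  next
    case False
    define q where "q = from_nat_into (\<rat> :: real set)"
    define w where "w n = (if \<exists>t\<in>T. t < q n then SOME t. t \<in> T \<and> t < q n else a)" for n
    have w: "w n \<in> T \<and> ((\<exists>t\<in>T. t < q n) \<longrightarrow> w n < q n)" for n
      unfolding w_def using assms someI_ex[of "\<lambda>t. t \<in> T \<and> t < q n"] by auto
    have "\<exists>n. w n \<le> t" if "t \<in> T" for t
    proof -
      obtain t' where t': "t' \<in> T" "t' < t" using False \<open>t \<in> T\<close> by force
      then obtain r where r: "r \<in> \<rat>" "t' < r" "r < t" using Rats_dense_in_real by blast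
      then obtain n where "q n = r"
        unfolding q_def using from_nat_into_surj[OF countable_rat, of r] by blast
      then have "w n \<le> t" using w[of n] t'(1) r by force
      then show ?thesis ..
    qed
    with w show ?thesis by blast
  qed
  then obtain w :: "nat \<Rightarrow> real" where w: "\<And>n. w n \<in> T" "\<And>t. t \<in> T \<Longrightarrow> \<exists>n. w n \<le> t" by blast
  define u where "u = rec_nat a (\<lambda>n y. min y (w n))"
  have u: "u 0 = a" "u (Suc n) = min (u n) (w n)" for n by (simp_all add: u_def)
  have "u n \<in> T" for n
    by (induction n) (use u assms w(1) in \<open>auto simp: min_def\<close>)
  moreover have "decseq u" using u by (simp add: decseq_Suc_iff)
  moreover have "\<exists>n. u n \<le> t" if "t \<in> T" for t
    using w(2)[OF that] u(2) by (metis min.coboundedI2)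
  ultimately show thesis using u(1) that by blast
qed

lemma pm_image_mono:
  assumes M: "persistence_module M" and "r \<le> s" "s \<le> t"
  shows "pm_map M r t ` pm_space M r \<subseteq> pm_map M s t ` pm_space M s"
proof
  fix z assume "z \<in> pm_map M r t ` pm_space M r"
  then obtain y where "y \<in> pm_space M r" "z = pm_map M s t (pm_map M r s y)"
    using assms by (auto simp: pm_comp)
  then show "z \<in> pm_map M s t ` pm_space M s"
    using pm_mem[OF M assms(2)] by blast
qed

text \<open>
  This is the Mittag-Leffler argument.  The vectors of \<open>M t\<close> that come from all earlier \<open>s \<in> T\<close> form
  the stable image \<open>E t\<close>, which by finite dimension is already the image from a single \<open>s\<close>.
  Therefore the maps between stable images are onto, and \<open>x\<close> can be lifted step by step along
  a coinitial sequence.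
\<close>

lemma section_through_images:
  fixes M :: "'k::field pmod"
  assumes M: "persistence_module M" and fd: "\<And>t. finite_dim (pm_space M t)"
    and T: "a \<in> T" "T \<subseteq> {..a}"
    and x: "x \<in> pm_space M a" "\<And>t. t \<in> T \<Longrightarrow> x \<in> pm_map M t a ` pm_space M t"
  obtains b where "bar M b" "b a = x" "\<And>t. t \<le> a \<Longrightarrow> b t \<noteq> 0 \<Longrightarrow> \<exists>s\<in>T. s \<le> t"
    "\<And>t. t \<in> T \<Longrightarrow> pm_map M t a (b t) = x"
proof -
  define im where "im s t = pm_map M s t ` pm_space M s" for s t
  define E where "E t = (\<Inter>s\<in>{s\<in>T. s \<le> t}. im s t)" for t
  have E_attained: "\<exists>s\<in>T. s \<le> t \<and> E t = im s t" if t: "t \<in> T" for t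
  proof -
    have *: "(\<lambda>s. im s t) ` {s\<in>T. s \<le> t} \<noteq> {}" using t by blast
    have 1: "vec.subspace U \<and> finite_dim U" if "U \<in> (\<lambda>s. im s t) ` {s\<in>T. s \<le> t}" for U
    proof -
      from that obtain s where s: "s \<le> t" "U = im s t" by blast
      have "U \<subseteq> pm_space M t" unfolding s(2) im_def using pm_mem[OF M s(1)] by blast
      then show ?thesis
        unfolding s(2) im_def
        using finite_dim_subset[OF fd] subspace_linear_image[OF pm_linear[OF M s(1)] pm_subspace[OF M]]
        by blast
    qed
    have 2: "U \<subseteq> V \<or> V \<subseteq> U"
      if UV: "U \<in> (\<lambda>s. im s t) ` {s\<in>T. s \<le> t}" "V \<in> (\<lambda>s. im s t) ` {s\<in>T. s \<le> t}" for U V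
    proof -
      obtain r s where rs: "r \<le> t" "s \<le> t" "U = im r t" "V = im s t" using UV by blast
      show ?thesis
        using pm_image_mono[OF M _ rs(2), of r] pm_image_mono[OF M _ rs(1), of s] linear[of r s]
        unfolding rs(3,4) im_def by blast
    qed
    obtain U where U: "U \<in> (\<lambda>s. im s t) ` {s\<in>T. s \<le> t}"
      "\<And>V. V \<in> (\<lambda>s. im s t) ` {s\<in>T. s \<le> t} \<Longrightarrow> U \<subseteq> V"
      using chain_of_subspaces_has_least[OF * 1 2] by blast
    have "E t = U" unfolding E_def using U by blast
    with U(1) show ?thesis by blast
  qed
  have E_lift: "\<exists>z\<in>E s. pm_map M s t z = y" if st: "s \<in> T" "s \<le> t" and y: "y \<in> E t" for s t y
  proof -
    obtain r where r: "r \<in> T" "r \<le> s" "E s = im r s" using E_attained[OF st(1)] by blast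
    have "y \<in> im r t" using y r st unfolding E_def by auto
    then obtain v where v: "v \<in> pm_space M r" "y = pm_map M r t v" by (auto simp: im_def)
    have "pm_map M r s v \<in> E s" unfolding r(3) im_def using v(1) by blast
    moreover have "pm_map M s t (pm_map M r s v) = y" using pm_comp[OF M r(2) st(2) v(1)] v(2) by simp
    ultimately show ?thesis by blast
  qed
  have E_sub: "E t \<subseteq> pm_space M t" if "t \<in> T" for t
  proof
    fix y assume "y \<in> E t"
    then have "y \<in> im t t" using that by (auto simp: E_def)
    then show "y \<in> pm_space M t" using pm_mem[OF M order_refl] by (auto simp: im_def)
  qed
  have "x \<in> E a" using x unfolding E_def im_def by blast

  obtain u where u: "u 0 = a" "\<And>n. u n \<in> T" "decseq u" "\<And>t. t \<in> T \<Longrightarrow> \<exists>n. u n \<le> t"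
    by (rule coinitial_sequence[OF T(1)]) blast
  have "\<exists>y. \<forall>n. (y n \<in> E (u n) \<and> (n = 0 \<longrightarrow> y n = x)) \<and> pm_map M (u (Suc n)) (u n) (y (Suc n)) = y n"
  proof (rule dependent_nat_choice)
    show "\<exists>y. y \<in> E (u 0) \<and> ((0::nat) = 0 \<longrightarrow> y = x)" using \<open>x \<in> E a\<close> u(1) by simp
    show "\<exists>z. (z \<in> E (u (Suc n)) \<and> (Suc n = 0 \<longrightarrow> z = x)) \<and> pm_map M (u (Suc n)) (u n) z = y"
      if "y \<in> E (u n) \<and> (n = 0 \<longrightarrow> y = x)" for y n
      using E_lift[OF u(2) _, of "Suc n" "u n" y] that decseq_SucD[OF u(3)] by auto
  qed
  then obtain y where y: "\<And>n. y n \<in> E (u n)" "y 0 = x"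
    "\<And>n. pm_map M (u (Suc n)) (u n) (y (Suc n)) = y n" by blast
  have yM: "y n \<in> pm_space M (u n)" for n using y(1) E_sub u(2) by blast
  have y_down: "pm_map M (u m) (u n) (y m) = y n" if "n \<le> m" for n m
    using that
  proof (induction m rule: dec_induct)
    case base then show ?case using pm_id[OF M yM] .
  next
    case (step m)
    have "pm_map M (u (Suc m)) (u n) (y (Suc m)) =
        pm_map M (u m) (u n) (pm_map M (u (Suc m)) (u m) (y (Suc m)))"
      using pm_comp[OF M decseq_SucD[OF u(3)] decseqD[OF u(3) step(1)] yM] by simp
    also have "\<dots> = y n" using y(3) step by simp
    finally show ?case .
  qed
  define b where "b t = (if \<exists>n. u n \<le> t then pm_map M (u (LEAST n. u n \<le> t)) t (y (LEAST n. u n \<le> t)) else 0)" for t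
  have b: "b t = pm_map M (u n) t (y n)" if "u n \<le> t" for n t
  proof -
    define k where "k = (LEAST n. u n \<le> t)"
    have k: "k \<le> n" "u k \<le> t" unfolding k_def using that by (auto intro: Least_le LeastI)
    have "b t = pm_map M (u k) t (y k)" using that by (auto simp: b_def k_def)
    also have "\<dots> = pm_map M (u k) t (pm_map M (u n) (u k) (y n))" using y_down[OF k(1)] by simp
    also have "\<dots> = pm_map M (u n) t (y n)" using pm_comp[OF M decseqD[OF u(3) k(1)] k(2) yM] .
    finally show ?thesis .
  qed
  have b_mem: "b t \<in> pm_space M t" for t
  proof (cases "\<exists>n. u n \<le> t")
    case True
    then obtain n where "u n \<le> t" by blast
    then show ?thesis using b pm_mem[OF M _ yM] by simp
  qed (simp add: b_def vec.subspace_0[OF pm_subspace[OF M]])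
  have b_map: "pm_map M s t (b s) = b t" if "s \<le> t" "u n \<le> s" for s t n
    using b[OF that(2)] b[of n t] pm_comp[OF M that(2,1) yM] that by simp
  have "bar M b"
    unfolding bar_def
  proof (intro conjI allI impI)
    show "b t \<in> pm_space M t" for t by (rule b_mem)
    show "pm_map M s t (b s) = b t" if "s \<le> t" "b s \<noteq> 0" for s t
    proof -
      obtain n where "u n \<le> s" using \<open>b s \<noteq> 0\<close> unfolding b_def by meson
      then show ?thesis using b_map \<open>s \<le> t\<close> by blast
    qed
  qed
  moreover have ba: "b a = x" using b[of 0 a] u(1) y(2) pm_id[OF M x(1)] by simp
  moreover have "\<exists>s\<in>T. s \<le> t" if "b t \<noteq> 0" for t
    using that u(2) unfolding b_def by meson
  moreover have "pm_map M t a (b t) = x" if "t \<in> T" for t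
    using u(4)[OF that] b_map[of t a] T(2) that ba by auto
  ultimately show thesis using that by blast
qed

lemma submodule_union_of_chain:
  assumes ne: "\<K> \<noteq> {}" and sub: "\<And>C. C \<in> \<K> \<Longrightarrow> submodule M C"
    and chain: "\<And>C D. C \<in> \<K> \<Longrightarrow> D \<in> \<K> \<Longrightarrow> C \<le> D \<or> D \<le> C"
  shows "submodule M (\<lambda>t. \<Union>C\<in>\<K>. C t)"
  unfolding submodule_def vec.subspace_def
proof (intro conjI allI ballI impI)
  fix t
  show "0 \<in> (\<Union>C\<in>\<K>. C t)"
    using ne vec.subspace_0[OF submodule_subspace[OF sub]] by blast
  show "(\<Union>C\<in>\<K>. C t) \<subseteq> pm_space M t"
    using submodule_subset[OF sub] by blast
  show "vscale c z \<in> (\<Union>C\<in>\<K>. C t)" if "z \<in> (\<Union>C\<in>\<K>. C t)" for c z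
    using that vec.subspace_scale[OF submodule_subspace[OF sub]] by blast
  show "z + z' \<in> (\<Union>C\<in>\<K>. C t)" if zz: "z \<in> (\<Union>C\<in>\<K>. C t)" "z' \<in> (\<Union>C\<in>\<K>. C t)" for z z'
  proof -
    obtain C D where CD: "C \<in> \<K>" "z \<in> C t" "D \<in> \<K>" "z' \<in> D t" using zz by blast
    then have "(z \<in> D t \<and> z' \<in> D t) \<or> (z \<in> C t \<and> z' \<in> C t)"
      using chain[OF CD(1,3)] by (auto simp: le_fun_def)
    then show ?thesis
      using CD vec.subspace_add[OF submodule_subspace[OF sub]] by blast
  qed
next
  show "pm_map M s t z \<in> (\<Union>C\<in>\<K>. C t)" if "s \<le> t" "z \<in> (\<Union>C\<in>\<K>. C s)" for s t z
    using that submodule_map[OF sub] by blast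
qed

text \<open>
  \<open>D\<close> is the submodule generated by \<open>C\<close> together with the single vector \<open>z\<close> at parameter \<open>t\<close>.
\<close>

lemma submodule_add_generated:
  assumes M: "persistence_module M" and C: "submodule M C" and z: "z \<in> pm_space M t"
  defines "D \<equiv> \<lambda>u. if t \<le> u then {w + vscale c (pm_map M t u z) | w c. w \<in> C u} else C u"
  shows "submodule M D" "C \<le> D" "z \<in> D t"
proof -
  note Csub = submodule_subspace[OF C]
  have CM: "w \<in> pm_space M u" if "w \<in> C u" for w u
    using that submodule_subset[OF C] by blast
  have DI: "w + vscale c (pm_map M t u z) \<in> D u" if "w \<in> C u" "t \<le> u" for w c u
    unfolding D_def using that by auto
  show CD: "C \<le> D"
    unfolding le_fun_def
  proof (intro allI subsetI)
    show "w \<in> D u" if "w \<in> C u" for u w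
      using DI[OF that, of 0] that by (cases "t \<le> u") (auto simp: D_def)
  qed
  show "z \<in> D t"
    using DI[OF vec.subspace_0[OF Csub] order_refl, of 1] pm_id[OF M z] by simp
  have Dsub: "vec.subspace (D u)" for u
  proof (cases "t \<le> u")
    case True
    show ?thesis
      unfolding vec.subspace_def
    proof (intro conjI ballI allI)
      show "0 \<in> D u" using CD vec.subspace_0[OF Csub] by (auto simp: le_fun_def)
      show "x + y \<in> D u" if xy: "x \<in> D u" "y \<in> D u" for x y
      proof -
        obtain w c w' c' where "w \<in> C u" "w' \<in> C u" and x: "x = w + vscale c (pm_map M t u z)"
          and y: "y = w' + vscale c' (pm_map M t u z)"
          using xy True unfolding D_def by auto
        then have "w + w' \<in> C u" using vec.subspace_add[OF Csub] by blast
        moreover have "x + y = (w + w') + vscale (c + c') (pm_map M t u z)"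
          unfolding x y vec.scale_left_distrib by (simp only: ac_simps)
        ultimately show ?thesis using DI[OF _ True] by metis
      qed
      show "vscale k x \<in> D u" if "x \<in> D u" for k x
      proof -
        obtain w c where "w \<in> C u" and x: "x = w + vscale c (pm_map M t u z)"
          using \<open>x \<in> D u\<close> True unfolding D_def by auto
        then have "vscale k w \<in> C u" using vec.subspace_scale[OF Csub] by blast
        moreover have "vscale k x = vscale k w + vscale (k * c) (pm_map M t u z)"
          unfolding x vec.scale_right_distrib vec.scale_scale ..
        ultimately show ?thesis using DI[OF _ True] by metis
      qed
    qed
  qed (simp add: D_def Csub)
  show "submodule M D"
    unfolding submodule_def
  proof (intro conjI allI ballI impI Dsub)
    show "D u \<subseteq> pm_space M u" for u
      using CM vec.subspace_add[OF pm_subspace[OF M]] vec.subspace_scale[OF pm_subspace[OF M]]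
        pm_mem[OF M _ z] by (auto simp: D_def)
    show "pm_map M s u y \<in> D u" if su: "s \<le> u" and y: "y \<in> D s" for s u y
    proof (cases "t \<le> s")
      case True
      then obtain w c where w: "w \<in> C s" and y: "y = w + vscale c (pm_map M t s z)"
        using y unfolding D_def by auto
      have "pm_map M s u y = pm_map M s u w + vscale c (pm_map M t u z)"
        unfolding y using pm_add[OF M su CM[OF w]] pm_scale[OF M su pm_mem[OF M True z]]
          vec.subspace_scale[OF pm_subspace[OF M] pm_mem[OF M True z]] pm_comp[OF M True su z] by simp
      then show ?thesis
        using DI[OF submodule_map[OF C su w]] True su by simp
    next
      case False
      then have "y \<in> C s" using y by (simp add: D_def)
      then show ?thesis using submodule_map[OF C su] CD by (auto simp: le_fun_def)
    qed
  qed
qed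

text \<open>
  The complement is a submodule \<open>C\<close> maximal among those that contain everything below the bar and
  avoid the bar from \<open>a\<close> on.  By maximality, each vector outside \<open>C\<close> has, further up, a nonzero
  multiple that agrees with the bar modulo \<open>C\<close>.  So at a fixed parameter all vectors are multiples of the bar
  modulo \<open>C\<close>, since a difference of two that agree further up cannot itself reach the bar.
  The hypotheses \<open>inj\<close> and \<open>fresh\<close> guarantee that the smallest candidate, generated by the spaces
  below the bar, does avoid the bar.
\<close>

lemma bar_complement:
  fixes M :: "'k::field pmod"
  assumes M: "persistence_module M" and x: "bar M x" and xa: "x a \<noteq> 0"
    and inj: "\<And>u z. a \<le> u \<Longrightarrow> x u \<noteq> 0 \<Longrightarrow> z \<in> pm_space M a \<Longrightarrow> pm_map M a u z = 0 \<Longrightarrow> z = 0"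
    and fresh: "\<And>l. l \<le> a \<Longrightarrow> x l = 0 \<Longrightarrow> x a \<notin> pm_map M l a ` pm_space M l"
  obtains C where "splits M x C"
proof -
  define good where "good C \<longleftrightarrow> submodule M C \<and> (\<forall>l\<le>a. x l = 0 \<longrightarrow> C l = pm_space M l) \<and>
     (\<forall>u\<ge>a. x u \<noteq> 0 \<longrightarrow> x u \<notin> C u)" for C
  define C0 where "C0 t = {0} \<union> (\<Union>l\<in>{l. l \<le> a \<and> l \<le> t \<and> x l = 0}. pm_map M l t ` pm_space M l)" for t
  have "good C0"
    unfolding good_def
  proof (intro conjI allI impI)
    show "submodule M C0"
      unfolding submodule_def
    proof (intro conjI allI ballI impI)
      fix t
      show "C0 t \<subseteq> pm_space M t"
        using pm_mem[OF M] vec.subspace_0[OF pm_subspace[OF M]] by (auto simp: C0_def)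
      show "vec.subspace (C0 t)"
        unfolding vec.subspace_def
      proof (intro conjI ballI allI)
        show "0 \<in> C0 t" by (simp add: C0_def)
        show "vscale c z \<in> C0 t" if z: "z \<in> C0 t" for c z
        proof (cases "z = 0")
          case False
          then obtain l y where l: "l \<le> a" "l \<le> t" "x l = 0" and y: "y \<in> pm_space M l" "z = pm_map M l t y"
            using z by (auto simp: C0_def)
          then have "vscale c z = pm_map M l t (vscale c y)" "vscale c y \<in> pm_space M l"
            using pm_scale[OF M] vec.subspace_scale[OF pm_subspace[OF M]] by auto
          then show ?thesis using l by (auto simp: C0_def)
        qed (simp add: C0_def)
        show "z + z' \<in> C0 t" if zz: "z \<in> C0 t" "z' \<in> C0 t" for z z'
        proof (cases "z = 0 \<or> z' = 0")
          case False
          obtain l y where l: "l \<le> a" "l \<le> t" "x l = 0" and y: "y \<in> pm_space M l" "z = pm_map M l t y"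
            using zz(1) False by (auto simp: C0_def)
          obtain l' y' where l': "l' \<le> a" "l' \<le> t" "x l' = 0" and y': "y' \<in> pm_space M l'" "z' = pm_map M l' t y'"
            using zz(2) False by (auto simp: C0_def)
          define m where "m = max l l'"
          have m: "m \<le> a" "m \<le> t" "x m = 0" "l \<le> m" "l' \<le> m" using l l' by (auto simp: m_def max_def)
          have "z = pm_map M m t (pm_map M l m y)" "z' = pm_map M m t (pm_map M l' m y')"
            using pm_comp[OF M m(4,2) y(1)] pm_comp[OF M m(5,2) y'(1)] y y' by auto
          then have "z + z' = pm_map M m t (pm_map M l m y + pm_map M l' m y')"
            using pm_add[OF M m(2) pm_mem[OF M m(4) y(1)] pm_mem[OF M m(5) y'(1)]] by simp
          moreover have "pm_map M l m y + pm_map M l' m y' \<in> pm_space M m"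
            using vec.subspace_add[OF pm_subspace[OF M]] pm_mem[OF M m(4) y(1)] pm_mem[OF M m(5) y'(1)] by blast
          ultimately show ?thesis using m by (auto simp: C0_def)
        qed (use zz in auto)
      qed
    next
      show "pm_map M s t z \<in> C0 t" if st: "s \<le> t" and z: "z \<in> C0 s" for s t z
      proof (cases "z = 0")
        case True
        then show ?thesis using pm_zero[OF M st] by (simp add: C0_def)
      next
        case False
        then obtain l y where l: "l \<le> a" "l \<le> s" "x l = 0" and y: "y \<in> pm_space M l" "z = pm_map M l s y"
          using z by (auto simp: C0_def)
        then have "pm_map M s t z = pm_map M l t y" using pm_comp[OF M l(2) st] by simp
        then show ?thesis using l y(1) st by (auto simp: C0_def)
      qed
    qed
    show "C0 l = pm_space M l" if "l \<le> a" "x l = 0" for l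
    proof
      show "C0 l \<subseteq> pm_space M l"
        using pm_mem[OF M] vec.subspace_0[OF pm_subspace[OF M]] by (auto simp: C0_def)
      show "pm_space M l \<subseteq> C0 l"
      proof
        fix z assume "z \<in> pm_space M l"
        then have "z \<in> pm_map M l l ` pm_space M l" using pm_id[OF M] by (metis imageI)
        then show "z \<in> C0 l" using that by (auto simp: C0_def)
      qed
    qed
    show "x u \<notin> C0 u" if u: "a \<le> u" "x u \<noteq> 0" for u
    proof
      assume "x u \<in> C0 u"
      then obtain l y where l: "l \<le> a" "x l = 0" and y: "y \<in> pm_space M l" "x u = pm_map M l u y"
        using u(2) by (auto simp: C0_def)
      have ya: "pm_map M l a y \<in> pm_space M a" using pm_mem[OF M l(1) y(1)] .
      have "pm_map M a u (x a - pm_map M l a y) = x u - pm_map M l u y"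
        using pm_diff[OF M u(1) bar_mem[OF x] ya] bar_map[OF x u(1) xa] pm_comp[OF M l(1) u(1) y(1)] by simp
      also have "\<dots> = 0" using y(2) by simp
      finally have "x a - pm_map M l a y = 0"
        by (rule inj[OF u vec.subspace_diff[OF pm_subspace[OF M] bar_mem[OF x] ya]])
      then show False using fresh[OF l] y(1) by auto
    qed
  qed

  \<comment> \<open>Families of subspaces are encoded by their graphs so that Zorn's lemma for inclusion applies.\<close>
  define G where "G = {Sigma UNIV C | C. good C}"
  have "(\<lambda>t. Sigma UNIV C `` {t}) = C" for C :: "real \<Rightarrow> (real \<Rightarrow> 'k) set" by auto
  then have slice: "good (\<lambda>t. P `` {t})" if "P \<in> G" for P using that by (force simp: G_def)
  have "\<exists>P\<in>G. \<forall>Q\<in>G. P \<subseteq> Q \<longrightarrow> Q = P"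
  proof (rule subset_Zorn_nonempty)
    show "G \<noteq> {}" using \<open>good C0\<close> by (auto simp: G_def)
    fix \<P> assume ne: "\<P> \<noteq> {}" and "subset.chain G \<P>"
    then have sub: "\<And>P. P \<in> \<P> \<Longrightarrow> P \<in> G" and chain: "\<And>P Q. P \<in> \<P> \<Longrightarrow> Q \<in> \<P> \<Longrightarrow> P \<subseteq> Q \<or> Q \<subseteq> P"
      by (auto simp: subset.chain_def)
    define \<K> where "\<K> = (\<lambda>P t. P `` {t}) ` \<P>"
    have \<K>: "\<And>C. C \<in> \<K> \<Longrightarrow> good C" using slice sub by (auto simp: \<K>_def)
    have eq: "(\<Union>C\<in>\<K>. C t) = \<Union>\<P> `` {t}" for t by (auto simp: \<K>_def)
    have "good (\<lambda>t. \<Union>C\<in>\<K>. C t)"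
      unfolding good_def
    proof (intro conjI allI impI)
      show "submodule M (\<lambda>t. \<Union>C\<in>\<K>. C t)"
      proof (rule submodule_union_of_chain)
        show "\<K> \<noteq> {}" using ne by (simp add: \<K>_def)
        show "submodule M C" if "C \<in> \<K>" for C using \<K>[OF that] by (simp add: good_def)
        show "C \<le> D \<or> D \<le> C" if CD: "C \<in> \<K>" "D \<in> \<K>" for C D
        proof -
          obtain P Q where "P \<in> \<P>" "Q \<in> \<P>" "C = (\<lambda>t. P `` {t})" "D = (\<lambda>t. Q `` {t})"
            using CD by (auto simp: \<K>_def)
          then show ?thesis using chain[of P Q] by (auto simp: le_fun_def)
        qed
      qed
      show "(\<Union>C\<in>\<K>. C l) = pm_space M l" if "l \<le> a" "x l = 0" for l
      proof -
        have "C l = pm_space M l" if "C \<in> \<K>" for C using \<K>[OF that] \<open>l \<le> a\<close> \<open>x l = 0\<close> by (simp add: good_def)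
        then show ?thesis using ne by (auto simp: \<K>_def)
      qed
      show "x u \<notin> (\<Union>C\<in>\<K>. C u)" if "a \<le> u" "x u \<noteq> 0" for u
        using \<K> that by (auto simp: good_def)
    qed
    moreover have "\<Union>\<P> = Sigma UNIV (\<lambda>t. \<Union>C\<in>\<K>. C t)" unfolding eq by auto
    ultimately show "\<Union>\<P> \<in> G" unfolding G_def by blast
  qed
  then obtain P where P: "P \<in> G" "\<And>Q. Q \<in> G \<Longrightarrow> P \<subseteq> Q \<Longrightarrow> Q = P" by blast
  obtain C where C: "good C" and PC: "P = Sigma UNIV C" using P(1) by (auto simp: G_def)
  have max: "D = C" if D: "good D" "C \<le> D" for D
  proof -
    have "P \<subseteq> Sigma UNIV D" using D(2) by (auto simp: PC le_fun_def)
    moreover have "Sigma UNIV D \<in> G" using D(1) by (auto simp: G_def)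
    ultimately have "Sigma UNIV D = Sigma UNIV C" using P(2) PC by blast
    then show ?thesis by (auto simp: fun_eq_iff set_eq_iff)
  qed
  have Cmod: "submodule M C" and Clow: "\<And>l. l \<le> a \<Longrightarrow> x l = 0 \<Longrightarrow> C l = pm_space M l"
    and avoid: "\<And>u. a \<le> u \<Longrightarrow> x u \<noteq> 0 \<Longrightarrow> x u \<notin> C u"
    using C by (auto simp: good_def)
  note Csub = submodule_subspace[OF Cmod]
  have hit: "\<exists>u w c. a \<le> u \<and> t \<le> u \<and> x u \<noteq> 0 \<and> w \<in> C u \<and> c \<noteq> 0 \<and> x u = w + vscale c (pm_map M t u z)"
    if z: "z \<in> pm_space M t" "z \<notin> C t" for t z
  proof -
    define D where "D = (\<lambda>u. if t \<le> u then {w + vscale c (pm_map M t u z) | w c. w \<in> C u} else C u)"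
    have D: "submodule M D" "C \<le> D" "z \<in> D t"
      using submodule_add_generated[OF M Cmod z(1)] unfolding D_def by auto
    then have "\<not> good D" using max z(2) by blast
    moreover have "D l = pm_space M l" if "l \<le> a" "x l = 0" for l
      using Clow[OF that] D(2) submodule_subset[OF D(1), of l] by (auto simp: le_fun_def)
    ultimately obtain u where u: "a \<le> u" "x u \<noteq> 0" "x u \<in> D u" using D(1) by (auto simp: good_def)
    then have "t \<le> u" using avoid[OF u(1,2)] by (auto simp: D_def split: if_splits)
    then obtain w c where w: "w \<in> C u" "x u = w + vscale c (pm_map M t u z)"
      using u(3) by (auto simp: D_def)
    have "c \<noteq> 0"
    proof
      assume "c = 0"
      then show False using w avoid[OF u(1,2)] by simp
    qed
    with u w \<open>t \<le> u\<close> show ?thesis by blast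
  qed
  have "splits M x C"
    unfolding splits_def
  proof (intro conjI allI ballI impI x Cmod)
    fix t
    show "x t \<notin> C t" if xt: "x t \<noteq> 0"
    proof (cases "a \<le> t")
      case True
      then show ?thesis using avoid xt by blast
    next
      case False
      then have "pm_map M t a (x t) = x a" using bar_map[OF x _ xt] by simp
      then show ?thesis using submodule_map[OF Cmod, of t a "x t"] False avoid[OF order_refl xa] by auto
    qed
    fix z assume z: "z \<in> pm_space M t"
    show "\<exists>c. z - vscale c (x t) \<in> C t"
    proof (cases "z \<in> C t")
      case True
      then show ?thesis by (intro exI[of _ 0]) simp
    next
      case False
      obtain u w c where u: "a \<le> u" "t \<le> u" "x u \<noteq> 0" "w \<in> C u" "c \<noteq> 0"
        "x u = w + vscale c (pm_map M t u z)"
        using hit[OF z False] by blast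
      have xt: "x t \<noteq> 0"
      proof
        assume "x t = 0"
        then have "a < t" using Clow[of t] False z by force
        then have "a \<le> t" by simp
        then have "pm_map M t u (x t) = x u"
          using bar_map[OF x _ xa, of t] bar_map[OF x u(1) xa] pm_comp[OF M \<open>a \<le> t\<close> u(2) bar_mem[OF x]]
          by simp
        then show False using \<open>x t = 0\<close> pm_zero[OF M u(2)] u(3) by simp
      qed
      \<comment> \<open>\<open>z'\<close> dies modulo \<open>C\<close> at \<open>u\<close>; were it outside \<open>C\<close>, it would reach the bar at some \<open>v\<close>, and at
        the later of the two parameters this would put the bar into \<open>C\<close>.\<close>
      define z' where "z' = x t - vscale c z"
      have z'M: "z' \<in> pm_space M t"
        unfolding z'_def using z bar_mem[OF x]
        by (intro vec.subspace_diff vec.subspace_scale pm_subspace[OF M]) auto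
      have "pm_map M t u z' = x u - vscale c (pm_map M t u z)"
        unfolding z'_def
        using pm_diff[OF M u(2) bar_mem[OF x]] vec.subspace_scale[OF pm_subspace[OF M] z] pm_scale[OF M u(2) z]
          bar_map[OF x u(2) xt] by simp
      then have z'C: "pm_map M t u z' \<in> C u" using u(4,6) by simp
      have "z' \<in> C t"
      proof (rule ccontr)
        assume "z' \<notin> C t"
        from hit[OF z'M this] obtain v w' c' where v: "a \<le> v" "t \<le> v" "x v \<noteq> 0" "w' \<in> C v"
          "x v = w' + vscale c' (pm_map M t v z')" by blast
        define m where "m = max u v"
        have m: "u \<le> m" "v \<le> m" "a \<le> m" "m = u \<or> m = v" using u(1) by (auto simp: m_def)
        have xm: "x m \<noteq> 0" using m(4) u(3) v(3) by auto
        have "pm_map M v m (pm_map M t v z') = pm_map M u m (pm_map M t u z')"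
          using pm_comp[OF M v(2) m(2) z'M] pm_comp[OF M u(2) m(1) z'M] by simp
        then have "pm_map M v m (pm_map M t v z') \<in> C m" using submodule_map[OF Cmod m(1) z'C] by simp
        moreover have "x m = pm_map M v m w' + vscale c' (pm_map M v m (pm_map M t v z'))"
        proof -
          have 1: "w' \<in> pm_space M v" using v(4) submodule_subset[OF Cmod] by blast
          have 2: "pm_map M t v z' \<in> pm_space M v" using pm_mem[OF M v(2) z'M] .
          have "x m = pm_map M v m (x v)" using bar_map[OF x m(2) v(3)] by simp
          also have "\<dots> = pm_map M v m w' + vscale c' (pm_map M v m (pm_map M t v z'))"
            unfolding v(5) using pm_add[OF M m(2) 1] vec.subspace_scale[OF pm_subspace[OF M] 2]
              pm_scale[OF M m(2) 2] by simp
          finally show ?thesis .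
        qed
        ultimately have "x m \<in> C m"
          using submodule_map[OF Cmod m(2) v(4)] vec.subspace_add[OF Csub] vec.subspace_scale[OF Csub] by metis
        then show False using avoid[OF m(3) xm] by blast
      qed
      then have "vscale (- inverse c) z' \<in> C t" by (rule vec.subspace_scale[OF Csub])
      moreover have "vscale (- inverse c) z' = z - vscale (inverse c) (x t)"
        using u(5) by (simp add: z'_def vec.scale_right_diff_distrib)
      ultimately show ?thesis by metis
    qed
  qed
  then show thesis by (rule that)
qed

text \<open>
  The value \<open>z\<close> of the bar at \<open>a\<close> lies in every nonzero kernel \<open>Ker M(a \<le> u)\<close>, so \<open>M(a \<le> u)\<close>
  is injective as long as the bar is alive; and the bar reaches down to every parameter whose image
  contains \<open>z\<close>.  These are the conditions under which it has a complement.
\<close>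

lemma exists_split_bar:
  fixes M :: "'k::field pmod"
  assumes M: "persistence_module M" and fd: "\<And>t. finite_dim (pm_space M t)"
    and z0: "z0 \<in> pm_space M a" "z0 \<noteq> 0"
  obtains x C where "splits M x C" "x a \<noteq> 0"
proof -
  define K where "K u = {z \<in> pm_space M a. pm_map M a u z = 0}" for u
  have K: "vec.subspace (K u)" if "a \<le> u" for u
    unfolding vec.subspace_def K_def
    using vec.subspace_0[OF pm_subspace[OF M]] vec.subspace_add[OF pm_subspace[OF M]]
      vec.subspace_scale[OF pm_subspace[OF M]] pm_zero[OF M that] pm_add[OF M that] pm_scale[OF M that]
    by simp
  have Kmono: "K u \<subseteq> K v" if "a \<le> u" "u \<le> v" for u v
    unfolding K_def using pm_comp[OF M that] pm_zero[OF M that(2)] by force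
  obtain z where z: "z \<in> pm_space M a" "z \<noteq> 0" "\<And>u. a \<le> u \<Longrightarrow> K u \<noteq> {0} \<Longrightarrow> z \<in> K u"
  proof (cases "\<exists>u\<ge>a. K u \<noteq> {0}")
    case False
    then show thesis using that z0 by blast
  next
    case True
    define \<F> where "\<F> = {K u | u. a \<le> u \<and> K u \<noteq> {0}}"
    have 1: "\<F> \<noteq> {}" using True by (auto simp: \<F>_def)
    have 2: "vec.subspace U \<and> finite_dim U" if "U \<in> \<F>" for U
    proof -
      obtain u where u: "a \<le> u" "U = K u" using \<open>U \<in> \<F>\<close> by (auto simp: \<F>_def)
      have "K u \<subseteq> pm_space M a" by (auto simp: K_def)
      then show ?thesis unfolding u(2) using K[OF u(1)] finite_dim_subset[OF fd] by blast
    qed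
    have 3: "U \<subseteq> V \<or> V \<subseteq> U" if UV: "U \<in> \<F>" "V \<in> \<F>" for U V
    proof -
      obtain u v where uv: "a \<le> u" "U = K u" "a \<le> v" "V = K v" using UV by (auto simp: \<F>_def)
      show ?thesis using Kmono[of u v] Kmono[of v u] uv linear[of u v] by auto
    qed
    obtain U where U: "U \<in> \<F>" "\<And>V. V \<in> \<F> \<Longrightarrow> U \<subseteq> V"
      using chain_of_subspaces_has_least[OF 1 2 3] by blast
    obtain u where u: "a \<le> u" "U = K u" "K u \<noteq> {0}" using U(1) by (auto simp: \<F>_def)
    then obtain z where z: "z \<in> U" "z \<noteq> 0" using vec.subspace_0[OF K[OF u(1)]] by blast
    moreover have "z \<in> pm_space M a" using z(1) u(2) by (simp add: K_def)
    moreover have "z \<in> K v" if "a \<le> v" "K v \<noteq> {0}" for v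
      using U(2)[of "K v"] z(1) that by (auto simp: \<F>_def)
    ultimately show thesis using that by blast
  qed
  define T where "T = {t. t \<le> a \<and> z \<in> pm_map M t a ` pm_space M t}"
  have aT: "a \<in> T" unfolding T_def using z(1) pm_id[OF M z(1)] by (metis (mono_tags, lifting) image_eqI mem_Collect_eq order_refl)
  have Ta: "T \<subseteq> {..a}" by (auto simp: T_def)
  have zT: "z \<in> pm_map M t a ` pm_space M t" if "t \<in> T" for t using that by (simp add: T_def)
  obtain x where x: "bar M x" "x a = z" "\<And>t. t \<le> a \<Longrightarrow> x t \<noteq> 0 \<Longrightarrow> \<exists>s\<in>T. s \<le> t"
    "\<And>t. t \<in> T \<Longrightarrow> pm_map M t a (x t) = z"
    using section_through_images[OF M fd aT Ta z(1) zT] by blast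
  have inj: "y = 0" if "a \<le> u" "x u \<noteq> 0" "y \<in> pm_space M a" "pm_map M a u y = 0" for u y
  proof (rule ccontr)
    assume "y \<noteq> 0"
    then have "K u \<noteq> {0}" using that by (auto simp: K_def)
    then have "pm_map M a u z = 0" using z(3)[OF that(1)] by (simp add: K_def)
    then show False using bar_map[OF x(1) that(1)] x(2) z(2) that(2) by simp
  qed
  have fresh: "x a \<notin> pm_map M l a ` pm_space M l" if "l \<le> a" "x l = 0" for l
  proof
    assume "x a \<in> pm_map M l a ` pm_space M l"
    then have "l \<in> T" using that(1) x(2) by (simp add: T_def)
    then show False using x(4)[of l] that pm_zero[OF M that(1)] z(2) by simp
  qed
  have xa: "x a \<noteq> 0" using x(2) z(2) by simp
  show thesis
    by (rule bar_complement[OF M x(1) xa inj fresh]) (use that xa in blast)+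
qed

section \<open>Decomposition into bars\<close>

definition bars_at :: "(real \<Rightarrow> real \<Rightarrow> 'k::field) set \<Rightarrow> real \<Rightarrow> (real \<Rightarrow> real \<Rightarrow> 'k) set" where
  "bars_at S t = {x \<in> S. x t \<noteq> 0}"

definition basis_at :: "(real \<Rightarrow> real \<Rightarrow> 'k::field) set \<Rightarrow> real \<Rightarrow> (real \<Rightarrow> 'k) set" where
  "basis_at S t = (\<lambda>x. x t) ` bars_at S t"

definition decomposes_at ::
  "(real \<Rightarrow> 'k::field) set \<Rightarrow> (real \<Rightarrow> real \<Rightarrow> 'k) set \<Rightarrow> (real \<Rightarrow> 'k) set \<Rightarrow> real \<Rightarrow> bool" where
  "decomposes_at V S U t \<longleftrightarrow> inj_on (\<lambda>x. x t) (bars_at S t) \<and> vec.independent (basis_at S t) \<and>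
     vec.span (basis_at S t) \<inter> U \<subseteq> {0} \<and> (\<forall>z\<in>V. \<exists>w\<in>vec.span (basis_at S t). z - w \<in> U)"

text \<open>
  A partial decomposition: the bars in \<open>S\<close> have been split off and \<open>C\<close> is what is left.
\<close>

definition decomposition ::
  "'k::field pmod \<Rightarrow> (real \<Rightarrow> real \<Rightarrow> 'k) set \<Rightarrow> (real \<Rightarrow> (real \<Rightarrow> 'k) set) \<Rightarrow> bool" where
  "decomposition M S C \<longleftrightarrow> (\<forall>x\<in>S. bar M x \<and> x \<noteq> 0) \<and> submodule M C \<and>
     (\<forall>t. decomposes_at (pm_space M t) S (C t) t)"

lemma decomposes_at_cong:
  "bars_at S t = bars_at S' t \<Longrightarrow> decomposes_at V S U t = decomposes_at V S' U t"
  by (simp add: decomposes_at_def basis_at_def)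

lemma decomposition_extend:
  fixes M :: "'k::field pmod"
  assumes dec: "decomposition M S C" and x: "splits (restrict_to M C) x C'" "x a \<noteq> 0"
  shows "decomposition M (insert x S) C'" "C' \<le> C" "C' \<noteq> C"
proof -
  have Cmod: "submodule M C" using dec by (simp add: decomposition_def)
  have xC: "x t \<in> C t" for t
    using x(1) by (simp add: splits_def bar_def restrict_to_def)
  have C': "vec.subspace (C' t)" "C' t \<subseteq> C t" for t
    using x(1) by (auto simp: splits_def submodule_def restrict_to_def)
  have xC': "x t \<notin> C' t" if "x t \<noteq> 0" for t
    using x(1) that by (simp add: splits_def)
  have ex: "\<exists>c. z - vscale c (x t) \<in> C' t" if "z \<in> C t" for z t
    using x(1) that by (simp add: splits_def restrict_to_def)
  show "C' \<le> C" using C'(2) by (simp add: le_fun_def)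
  show "C' \<noteq> C" using xC xC'[OF x(2)] by blast
  have "bar M x"
    using x(1) subsetD[OF submodule_subset[OF Cmod]] by (simp add: splits_def bar_def restrict_to_def)
  moreover have "submodule M C'"
    using x(1) Cmod by (fastforce simp: splits_def submodule_def restrict_to_def)
  moreover have "x \<noteq> 0" using x(2) by auto
  moreover have "decomposes_at (pm_space M t) (insert x S) (C' t) t" for t
  proof -
    have d: "inj_on (\<lambda>x. x t) (bars_at S t)" "vec.independent (basis_at S t)"
      "vec.span (basis_at S t) \<inter> C t \<subseteq> {0}"
      "\<And>z. z \<in> pm_space M t \<Longrightarrow> \<exists>w\<in>vec.span (basis_at S t). z - w \<in> C t"
      using dec by (auto simp: decomposition_def decomposes_at_def)
    show ?thesis
    proof (cases "x t = 0")
      case True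
      have "C t \<subseteq> C' t" using ex[of _ t] True by auto
      then have "C' t = C t" using C'(2) by blast
      moreover have "bars_at (insert x S) t = bars_at S t" using True by (auto simp: bars_at_def)
      ultimately show ?thesis using dec by (simp add: decomposition_def decomposes_at_cong[of _ t S])
    next
      case False
      have bars: "bars_at (insert x S) t = insert x (bars_at S t)" using False by (auto simp: bars_at_def)
      then have basis: "basis_at (insert x S) t = insert (x t) (basis_at S t)" by (simp add: basis_at_def)
      have notin: "x t \<notin> vec.span (basis_at S t)" using d(3) xC False by blast
      have "x t \<notin> basis_at S t" using notin vec.span_base by blast
      show ?thesis
        unfolding decomposes_at_def basis
      proof (intro conjI ballI)
        show "inj_on (\<lambda>x. x t) (bars_at (insert x S) t)"
          unfolding bars using d(1) \<open>x t \<notin> basis_at S t\<close> by (auto simp: basis_at_def)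
        show "vec.independent (insert (x t) (basis_at S t))"
          using vec.independent_insertI[OF notin d(2)] .
        show "vec.span (insert (x t) (basis_at S t)) \<inter> C' t \<subseteq> {0}"
        proof
          fix z assume z: "z \<in> vec.span (insert (x t) (basis_at S t)) \<inter> C' t"
          then obtain k where k: "z - vscale k (x t) \<in> vec.span (basis_at S t)"
            using vec.span_breakdown_eq[of z "x t" "basis_at S t"] by auto
          have "z - vscale k (x t) \<in> C t"
            using z C'(2) xC by (intro vec.subspace_diff vec.subspace_scale submodule_subspace[OF Cmod]) auto
          then have "z - vscale k (x t) = 0" using k d(3) by blast
          then have zk: "z = vscale k (x t)" by (rule eq_iff_diff_eq_0[THEN iffD2])
          have "k = 0"
          proof (rule ccontr)
            assume "k \<noteq> 0"
            then have "x t = vscale (inverse k) z" unfolding zk by simp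
            then have "x t \<in> C' t" using z vec.subspace_scale[OF C'(1)] by auto
            then show False using xC' False by blast
          qed
          with zk show "z \<in> {0}" by simp
        qed
        fix z assume "z \<in> pm_space M t"
        then obtain w where w: "w \<in> vec.span (basis_at S t)" "z - w \<in> C t" using d(4) by blast
        then obtain c where c: "z - w - vscale c (x t) \<in> C' t" using ex by blast
        have "w + vscale c (x t) \<in> vec.span (insert (x t) (basis_at S t))"
          by (intro vec.span_add vec.span_scale vec.span_base insertI1
              subsetD[OF vec.span_mono w(1)] subset_insertI)
        moreover have "z - (w + vscale c (x t)) \<in> C' t" using c by (simp only: diff_diff_eq)
        ultimately show "\<exists>w\<in>vec.span (insert (x t) (basis_at S t)). z - w \<in> C' t" by blast
      qed
    qed
  qed
  ultimately show "decomposition M (insert x S) C'"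
    using dec by (simp add: decomposition_def)
qed

text \<open>
  At a fixed parameter \<open>t\<close>, pick a member \<open>(S1, C1)\<close> of the chain whose complement is smallest
  at \<open>t\<close>.  Later members have the same complement there, so they cannot contain
  further bars alive at \<open>t\<close>: these would be linear combinations of earlier ones.
\<close>

lemma decomposition_limit:
  fixes M :: "'k::field pmod"
  assumes fd: "\<And>t. finite_dim (pm_space M t)"
    and ne: "\<K> \<noteq> {}" and dec: "\<And>S C. (S, C) \<in> \<K> \<Longrightarrow> decomposition M S C"
    and chain: "\<And>S C S' C'. (S, C) \<in> \<K> \<Longrightarrow> (S', C') \<in> \<K> \<Longrightarrow> (S \<subseteq> S' \<and> C' \<le> C) \<or> (S' \<subseteq> S \<and> C \<le> C')"
  shows "decomposition M (\<Union>(S, C)\<in>\<K>. S) (\<lambda>t. \<Inter>(S, C)\<in>\<K>. C t)"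
proof -
  define S where "S = (\<Union>(S, C)\<in>\<K>. S)"
  define C where "C = (\<lambda>t. \<Inter>(S, C)\<in>\<K>. C t)"
  have mod: "submodule M C'" if "(S', C') \<in> \<K>" for S' C' using dec[OF that] by (simp add: decomposition_def)
  have Csub: "C t \<subseteq> C' t" if "(S', C') \<in> \<K>" for S' C' t using that by (auto simp: C_def)
  have CI: "z \<in> C t" if "\<And>S' C'. (S', C') \<in> \<K> \<Longrightarrow> z \<in> C' t" for z t using that by (auto simp: C_def)
  obtain S0 C0 where k0: "(S0, C0) \<in> \<K>" using ne by auto
  have "submodule M C"
    unfolding submodule_def vec.subspace_def
  proof (intro conjI allI ballI impI)
    fix t
    show "0 \<in> C t" using vec.subspace_0[OF submodule_subspace[OF mod]] by (intro CI) blast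
    show "x + y \<in> C t" if "x \<in> C t" "y \<in> C t" for x y
      using vec.subspace_add[OF submodule_subspace[OF mod]] that Csub by (intro CI) blast
    show "vscale c x \<in> C t" if "x \<in> C t" for c x
      using vec.subspace_scale[OF submodule_subspace[OF mod]] that Csub by (intro CI) blast
    show "C t \<subseteq> pm_space M t" using Csub[OF k0] submodule_subset[OF mod[OF k0]] by blast
  next
    show "pm_map M s t z \<in> C t" if "s \<le> t" "z \<in> C s" for s t z
      using submodule_map[OF mod that(1)] that(2) Csub by (intro CI) blast
  qed
  moreover have "bar M x \<and> x \<noteq> 0" if "x \<in> S" for x
    using that dec by (auto simp: S_def decomposition_def)
  moreover have "decomposes_at (pm_space M t) S (C t) t" for t
  proof -
    define \<F> where "\<F> = (\<lambda>(S, C). C t) ` \<K>"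
    have 1: "\<F> \<noteq> {}" using ne by (simp add: \<F>_def)
    have 2: "vec.subspace U \<and> finite_dim U" if "U \<in> \<F>" for U
    proof -
      obtain S' C' where "(S', C') \<in> \<K>" "U = C' t" using \<open>U \<in> \<F>\<close> by (auto simp: \<F>_def)
      then show ?thesis
        using submodule_subspace[OF mod] finite_dim_subset[OF fd submodule_subset[OF mod]] by blast
    qed
    have 3: "U \<subseteq> V \<or> V \<subseteq> U" if UV: "U \<in> \<F>" "V \<in> \<F>" for U V
    proof -
      obtain S1 C1 S2 C2 where "(S1, C1) \<in> \<K>" "U = C1 t" "(S2, C2) \<in> \<K>" "V = C2 t"
        using UV by (auto simp: \<F>_def)
      then show ?thesis using chain[of S1 C1 S2 C2] by (auto simp: le_fun_def)
    qed
    obtain U where U: "U \<in> \<F>" "\<And>V. V \<in> \<F> \<Longrightarrow> U \<subseteq> V"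
      using chain_of_subspaces_has_least[OF 1 2 3] by blast
    obtain S1 C1 where k1: "(S1, C1) \<in> \<K>" "U = C1 t" using U(1) by (auto simp: \<F>_def)
    have least: "C1 t \<subseteq> C' t" if "(S', C') \<in> \<K>" for S' C'
      using U(2)[of "C' t"] that k1(2) by (force simp: \<F>_def)
    have Ct: "C t = C1 t" using Csub[OF k1(1)] least by (intro equalityI subsetI CI) blast+
    have d1: "decomposes_at (pm_space M t) S1 (C1 t) t" using dec[OF k1(1)] by (simp add: decomposition_def)
    have "x \<in> S1" if x: "x \<in> S" "x t \<noteq> 0" for x
    proof (rule ccontr)
      assume nx: "x \<notin> S1"
      obtain S2 C2 where k2: "(S2, C2) \<in> \<K>" "x \<in> S2" using x(1) by (auto simp: S_def)
      then have S12: "S1 \<subseteq> S2" "C2 \<le> C1" using chain[OF k1(1) k2(1)] nx by auto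
      then have C12: "C2 t = C1 t" using least[OF k2(1)] by (auto simp: le_fun_def)
      have d2: "decomposes_at (pm_space M t) S2 (C1 t) t"
        unfolding C12[symmetric] using dec[OF k2(1)] by (simp add: decomposition_def)
      have b12: "bars_at S1 t \<subseteq> bars_at S2 t" using S12 by (auto simp: bars_at_def)
      have xb: "x \<in> bars_at S2 t" "x \<notin> bars_at S1 t" using x(2) k2(2) nx by (auto simp: bars_at_def)
      have "x t \<notin> basis_at S1 t"
      proof
        assume "x t \<in> basis_at S1 t"
        then obtain y where "y \<in> bars_at S1 t" "x t = y t" by (auto simp: basis_at_def)
        then show False using d2 b12 xb unfolding decomposes_at_def by (metis inj_onD subsetD)
      qed
      then have B: "basis_at S1 t \<subseteq> basis_at S2 t - {x t}"
        using b12 unfolding basis_at_def by blast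
      have "bar M x" using dec[OF k2(1)] k2(2) by (simp add: decomposition_def)
      then obtain w where w: "w \<in> vec.span (basis_at S1 t)" "x t - w \<in> C1 t"
        using d1 bar_mem unfolding decomposes_at_def by blast
      have "x t \<in> vec.span (basis_at S2 t)" using xb(1) by (intro vec.span_base) (simp add: basis_at_def)
      moreover have "w \<in> vec.span (basis_at S2 t)" using w(1) vec.span_mono B by blast
      ultimately have "x t - w \<in> vec.span (basis_at S2 t)" by (rule vec.span_diff)
      then have "x t - w = 0" using d2 w(2) unfolding decomposes_at_def by blast
      then have "x t = w" by (rule eq_iff_diff_eq_0[THEN iffD2])
      then have "x t \<in> vec.span (basis_at S2 t - {x t})" using w(1) vec.span_mono[OF B] by auto
      moreover have "x t \<in> basis_at S2 t" using xb(1) by (simp add: basis_at_def)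
      ultimately show False using d2 unfolding decomposes_at_def vec.dependent_def by blast
    qed
    then have "bars_at S t = bars_at S1 t" using k1(1) by (auto simp: bars_at_def S_def)
    then show ?thesis using d1 unfolding Ct by (simp add: decomposes_at_cong[of S t S1])
  qed
  ultimately show ?thesis
    unfolding S_def[symmetric] C_def[symmetric] decomposition_def by blast
qed

text \<open>
  From the complement of a maximal partial decomposition no bar can be split off, so it is zero.
\<close>

theorem bar_decomposition:
  fixes M :: "'k::field pmod"
  assumes M: "persistence_module M" and fd: "\<And>t. finite_dim (pm_space M t)"
  obtains S where "\<And>x. x \<in> S \<Longrightarrow> bar M x \<and> x \<noteq> 0"
    "\<And>t. inj_on (\<lambda>x. x t) (bars_at S t)" "\<And>t. vec.independent (basis_at S t)"
    "\<And>t. vec.span (basis_at S t) = pm_space M t"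
proof -
  define A where "A = {(S, C). decomposition M S C}"
  define le where "le = (\<lambda>(S :: (real \<Rightarrow> real \<Rightarrow> 'k) set, C :: real \<Rightarrow> (real \<Rightarrow> 'k) set) (S', C'). S \<subseteq> S' \<and> C' \<le> C)"
  have "\<exists>m\<in>A. \<forall>k\<in>A. le m k \<longrightarrow> k = m"
  proof (rule predicate_Zorn)
    show "partial_order_on A (relation_of le A)"
      by (rule partial_order_on_relation_ofI) (auto simp: le_def)
    fix \<K> assume "\<K> \<in> Chains (relation_of le A)"
    then have dec: "\<And>k. k \<in> \<K> \<Longrightarrow> k \<in> A" and chain: "\<And>k k'. k \<in> \<K> \<Longrightarrow> k' \<in> \<K> \<Longrightarrow> le k k' \<or> le k' k"
      by (auto simp: Chains_def relation_of_def)
    show "\<exists>u\<in>A. \<forall>k\<in>\<K>. le k u"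
    proof (cases "\<K> = {}")
      case True
      have "submodule M (pm_space M)"
        using pm_subspace[OF M] pm_mem[OF M] by (simp add: submodule_def)
      then have "decomposition M {} (pm_space M)"
        by (auto simp: decomposition_def decomposes_at_def bars_at_def basis_at_def vec.independent_empty)
      then show ?thesis using True by (auto simp: A_def)
    next
      case False
      have "decomposition M (\<Union>(S, C)\<in>\<K>. S) (\<lambda>t. \<Inter>(S, C)\<in>\<K>. C t)"
      proof (rule decomposition_limit[OF fd False])
        show "decomposition M S C" if "(S, C) \<in> \<K>" for S C using dec[OF that] by (simp add: A_def)
        show "(S \<subseteq> S' \<and> C' \<le> C) \<or> (S' \<subseteq> S \<and> C \<le> C')" if "(S, C) \<in> \<K>" "(S', C') \<in> \<K>" for S C S' C'
          using chain[OF that] by (simp add: le_def)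
      qed
      then show ?thesis
        by (intro bexI[of _ "(\<Union>(S, C)\<in>\<K>. S, \<lambda>t. \<Inter>(S, C)\<in>\<K>. C t)"])
          (auto simp: A_def le_def le_fun_def)
    qed
  qed
  then obtain S C where m: "(S, C) \<in> A" "\<forall>k\<in>A. le (S, C) k \<longrightarrow> k = (S, C)" by auto
  then have dec: "decomposition M S C" by (simp add: A_def)
  have max: "S' = S \<and> C' = C" if "decomposition M S' C'" "S \<subseteq> S'" "C' \<le> C" for S' C'
    using bspec[OF m(2), of "(S', C')"] that by (simp add: A_def le_def)
  have Cmod: "submodule M C" using dec by (simp add: decomposition_def)
  have C0: "C t = {0}" for t
  proof (rule ccontr)
    assume "C t \<noteq> {0}"
    then obtain z where z: "z \<in> C t" "z \<noteq> 0" using vec.subspace_0[OF submodule_subspace[OF Cmod]] by blast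
    have "finite_dim (pm_space (restrict_to M C) u)" for u
      using finite_dim_subset[OF fd submodule_subset[OF Cmod]] by (simp add: restrict_to_def)
    moreover have "z \<in> pm_space (restrict_to M C) t" using z(1) by (simp add: restrict_to_def)
    ultimately obtain x C' where x: "splits (restrict_to M C) x C'" "x t \<noteq> 0"
      using exists_split_bar[OF persistence_module_restrict_to[OF M Cmod] _ _ z(2)] by blast
    show False
      using decomposition_extend[OF dec x] max[of "insert x S" C'] by blast
  qed
  have d: "decomposes_at (pm_space M t) S {0} t" for t using dec C0 by (simp add: decomposition_def)
  have "vec.span (basis_at S t) = pm_space M t" for t
  proof
    have "basis_at S t \<subseteq> pm_space M t"
      using dec by (auto simp: decomposition_def basis_at_def bars_at_def bar_def)
    then show "vec.span (basis_at S t) \<subseteq> pm_space M t"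
      by (rule vec.span_minimal[OF _ pm_subspace[OF M]])
    show "pm_space M t \<subseteq> vec.span (basis_at S t)"
    proof
      fix z assume "z \<in> pm_space M t"
      then obtain w where w: "w \<in> vec.span (basis_at S t)" "z - w = 0"
        using d[of t] unfolding decomposes_at_def by blast
      from w(2) have "z = w" by (rule eq_iff_diff_eq_0[THEN iffD2])
      with w(1) show "z \<in> vec.span (basis_at S t)" by simp
    qed
  qed
  moreover have "bar M x \<and> x \<noteq> 0" if "x \<in> S" for x
    using dec that by (simp add: decomposition_def)
  ultimately show thesis using that[of S] d unfolding decomposes_at_def by blast
qed

section \<open>Direct sums of interval modules\<close>

lemma interval_sum_mem_iff:
  "v \<in> pm_space (interval_sum A I) t \<longleftrightarrow>
     finite {\<alpha>. v \<alpha> \<noteq> 0} \<and> (\<forall>\<alpha>. v \<alpha> \<noteq> 0 \<longrightarrow> \<alpha> \<in> A \<and> t \<in> I \<alpha>)"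
  by (auto simp: interval_sum_def interval_space_def)

lemma interval_sum_map:
  "pm_map (interval_sum A I) s t v = (\<lambda>\<alpha>. if s \<in> I \<alpha> \<and> t \<in> I \<alpha> then v \<alpha> else 0)"
  by (simp add: interval_sum_def interval_map_def fun_eq_iff)

lemma interval_sum_subspace: "vec.subspace (pm_space (interval_sum A I :: 'k::field pmod) t)"
  unfolding vec.subspace_def
proof (intro conjI ballI allI)
  let ?V = "pm_space (interval_sum A I :: 'k pmod) t"
  show "0 \<in> ?V" by (simp add: interval_sum_mem_iff)
  show "u + v \<in> ?V" if uv: "u \<in> ?V" "v \<in> ?V" for u v
  proof -
    have "{\<alpha>. (u + v) \<alpha> \<noteq> 0} \<subseteq> {\<alpha>. u \<alpha> \<noteq> 0} \<union> {\<alpha>. v \<alpha> \<noteq> 0}" by auto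
    then have "finite {\<alpha>. (u + v) \<alpha> \<noteq> 0}"
      by (rule finite_subset) (use uv in \<open>simp add: interval_sum_mem_iff\<close>)
    moreover have "u \<alpha> \<noteq> 0 \<or> v \<alpha> \<noteq> 0" if "(u + v) \<alpha> \<noteq> 0" for \<alpha> using that by auto
    ultimately show ?thesis using uv unfolding interval_sum_mem_iff by blast
  qed
  show "vscale c v \<in> ?V" if v: "v \<in> ?V" for c v
  proof -
    have "{\<alpha>. vscale c v \<alpha> \<noteq> 0} \<subseteq> {\<alpha>. v \<alpha> \<noteq> 0}" by (auto simp: vscale_def)
    then have "finite {\<alpha>. vscale c v \<alpha> \<noteq> 0}"
      by (rule finite_subset) (use v in \<open>simp add: interval_sum_mem_iff\<close>)
    then show ?thesis using v by (auto simp: interval_sum_mem_iff vscale_def)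
  qed
qed

lemma interval_sum_truncate:
  assumes v: "v \<in> pm_space (interval_sum A I) s" and w: "\<And>\<alpha>. w \<alpha> \<noteq> 0 \<Longrightarrow> w \<alpha> = v \<alpha> \<and> t \<in> I' \<alpha>"
  shows "w \<in> pm_space (interval_sum A I') t"
proof -
  have "{\<alpha>. w \<alpha> \<noteq> 0} \<subseteq> {\<alpha>. v \<alpha> \<noteq> 0}" using w by force
  then have "finite {\<alpha>. w \<alpha> \<noteq> 0}"
    by (rule finite_subset) (use v in \<open>simp add: interval_sum_mem_iff\<close>)
  then show ?thesis using v w by (force simp: interval_sum_mem_iff)
qed

lemma persistence_module_interval_sum:
  assumes I: "\<And>\<alpha>. \<alpha> \<in> A \<Longrightarrow> is_interval (I \<alpha>)"
  shows "persistence_module (interval_sum A I :: 'k::field pmod)"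
  unfolding persistence_module_def
proof (intro conjI allI ballI impI)
  let ?M = "interval_sum A I :: 'k pmod"
  show "vec.subspace (pm_space ?M a)" for a by (rule interval_sum_subspace)
  show "linear_between (pm_space ?M a) (pm_space ?M b) (pm_map ?M a b)" for a b
    unfolding linear_between_def
  proof (intro conjI ballI allI)
    show "pm_map ?M a b \<in> pm_space ?M a \<rightarrow> pm_space ?M b"
    proof
      show "pm_map ?M a b v \<in> pm_space ?M b" if "v \<in> pm_space ?M a" for v
        using that by (rule interval_sum_truncate) (auto simp: interval_sum_map split: if_splits)
    qed
  qed (auto simp: interval_sum_map fun_eq_iff vscale_def)
  show "pm_map ?M a a x = x" if "x \<in> pm_space ?M a" for a x
    using that by (auto simp: interval_sum_map interval_sum_mem_iff fun_eq_iff)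
  show "pm_map ?M b c (pm_map ?M a b x) = pm_map ?M a c x"
    if "a \<le> b" "b \<le> c" "x \<in> pm_space ?M a" for a b c x
  proof
    fix \<alpha>
    have "b \<in> I \<alpha>" if "x \<alpha> \<noteq> 0" "a \<in> I \<alpha>" "c \<in> I \<alpha>"
    proof -
      have "\<alpha> \<in> A" using \<open>x \<in> pm_space ?M a\<close> \<open>x \<alpha> \<noteq> 0\<close> by (simp add: interval_sum_mem_iff)
      then show ?thesis using I mem_is_interval_1_I \<open>a \<le> b\<close> \<open>b \<le> c\<close> that by blast
    qed
    then show "pm_map ?M b c (pm_map ?M a b x) \<alpha> = pm_map ?M a c x \<alpha>"
      by (auto simp: interval_sum_map)
  qed
qed

section \<open>Bars and interval modules\<close>

lemma bar_support_interval:
  assumes M: "persistence_module M" and x: "bar M x" "x \<noteq> 0"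
  shows "interval {t. x t \<noteq> 0}"
proof -
  have "x t \<noteq> 0" if "x r \<noteq> 0" "x u \<noteq> 0" "r \<le> t" "t \<le> u" for r t u
  proof
    assume "x t = 0"
    have "x u = pm_map M t u (pm_map M r t (x r))"
      using bar_map[OF x(1) _ that(1)] pm_comp[OF M that(3,4) bar_mem[OF x(1)]] that(3,4) by simp
    also have "pm_map M r t (x r) = 0" using bar_map[OF x(1) that(3,1)] \<open>x t = 0\<close> by (rule trans)
    also have "pm_map M t u 0 = 0" using pm_zero[OF M that(4)] .
    finally show False using that(2) by contradiction
  qed
  moreover have "\<exists>t. x t \<noteq> 0" using x(2) by (auto simp: fun_eq_iff[of x])
  ultimately show ?thesis
    unfolding interval_def is_interval_1 by blast
qed

text \<open>
  Only finitely many bars are alive at one parameter, so a bar is determined by a parameter of its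
  support together with its number in an enumeration there.  The pair is coded as a real number: arctan squeezes the
  parameter into an interval of length less than \<open>4\<close>, and the numbers are spaced \<open>4\<close> apart.
\<close>

lemma real_indexing:
  fixes S :: "(real \<Rightarrow> real \<Rightarrow> 'k::field) set"
  assumes fin: "\<And>t. finite (bars_at S t)" and ne: "\<And>x. x \<in> S \<Longrightarrow> x \<noteq> 0"
  obtains f :: "(real \<Rightarrow> real \<Rightarrow> 'k) \<Rightarrow> real" where "inj_on f S"
proof -
  define \<tau> where "\<tau> x = (SOME t. x t \<noteq> 0)" for x :: "real \<Rightarrow> real \<Rightarrow> 'k"
  have \<tau>: "x \<in> bars_at S (\<tau> x)" if "x \<in> S" for x
  proof -
    have "\<exists>t. x t \<noteq> 0" using ne[OF that] by (auto simp: fun_eq_iff[of x])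
    then have "x (\<tau> x) \<noteq> 0" unfolding \<tau>_def by (rule someI_ex)
    then show ?thesis using that by (simp add: bars_at_def)
  qed
  define f where "f x = arctan (\<tau> x) + 4 * real (to_nat_on (bars_at S (\<tau> x)) x)" for x
  have "inj_on f S"
  proof (rule inj_onI)
    fix x y assume xy: "x \<in> S" "y \<in> S" "f x = f y"
    define m n where "m = to_nat_on (bars_at S (\<tau> x)) x" and "n = to_nat_on (bars_at S (\<tau> y)) y"
    have eq: "arctan (\<tau> x) + 4 * real m = arctan (\<tau> y) + 4 * real n"
      using xy(3) by (simp add: f_def m_def n_def)
    have "\<bar>arctan (\<tau> x)\<bar> < 2" "\<bar>arctan (\<tau> y)\<bar> < 2"
      using arctan_bounded[of "\<tau> x"] arctan_bounded[of "\<tau> y"] pi_less_4 by auto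
    then have "real m < real n + 1" "real n < real m + 1" using eq by linarith+
    then have "m = n" by linarith
    moreover from this eq have "\<tau> x = \<tau> y" by (simp add: arctan_eq_iff)
    ultimately show "x = y"
      using inj_on_to_nat_on[OF countable_finite[OF fin]] \<tau>[OF xy(1)] \<tau>[OF xy(2)]
      unfolding m_def n_def by (metis inj_onD)
  qed
  then show thesis by (rule that)
qed

text \<open>
  The coefficient of a vector at the index \<open>f x\<close> is its coordinate with respect to the bar \<open>x\<close>.
  Hence the comparison map \<open>\<theta>\<close> sends a family of coefficients to the linear combination of the bars
  that are alive.
\<close>

theorem pfd_interval_decomposition:
  fixes M :: "'k::field pmod"
  assumes M: "persistence_module M" and fd: "\<And>t. finite_dim (pm_space M t)"
  obtains A I where "\<And>\<alpha>. \<alpha> \<in> A \<Longrightarrow> interval (I \<alpha>)" "isomorphic M (interval_sum A I)"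
proof -
  obtain S where S: "\<And>x. x \<in> S \<Longrightarrow> bar M x \<and> x \<noteq> 0"
    "\<And>t. inj_on (\<lambda>x. x t) (bars_at S t)" "\<And>t. vec.independent (basis_at S t)"
    "\<And>t. vec.span (basis_at S t) = pm_space M t"
    using bar_decomposition[OF M fd] by blast
  have finB: "finite (basis_at S t)" for t
  proof -
    obtain B where B: "finite B" "pm_space M t \<subseteq> vec.span B" using fd by (auto simp: finite_dim_def)
    moreover have "basis_at S t \<subseteq> pm_space M t" using S(4) vec.span_superset by blast
    ultimately show ?thesis using vec.independent_span_bound[OF B(1) S(3)] by blast
  qed
  then have fin: "finite (bars_at S t)" for t
    using finite_imageD[OF _ S(2)] unfolding basis_at_def by blast
  obtain f :: "(real \<Rightarrow> real \<Rightarrow> 'k) \<Rightarrow> real" where f: "inj_on f S"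
    using real_indexing[OF fin] S(1) by blast
  define A where "A = f ` S"
  define g where "g = inv_into S f"
  define I where "I \<alpha> = {t. g \<alpha> t \<noteq> 0}" for \<alpha>
  have gf: "g (f x) = x" if "x \<in> S" for x using f that by (simp add: g_def)
  have gS: "g \<alpha> \<in> S" if "\<alpha> \<in> A" for \<alpha> using that gf by (auto simp: A_def)
  have "interval (I \<alpha>)" if "\<alpha> \<in> A" for \<alpha>
    unfolding I_def using bar_support_interval[OF M] S(1)[OF gS[OF that]] by blast
  moreover have "isomorphic (interval_sum A I) M"
  proof -
    define J where "J t = {\<alpha> \<in> A. t \<in> I \<alpha>}" for t
    have gJ: "bij_betw g (J t) (bars_at S t)" for t
      by (rule bij_betw_byWitness[where f' = f]) (auto simp: J_def A_def I_def bars_at_def gf)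
    have bij: "bij_betw (\<lambda>\<alpha>. g \<alpha> t) (J t) (basis_at S t)" for t
      using bij_betw_trans[OF gJ inj_on_imp_bij_betw[OF S(2)]] by (simp add: comp_def basis_at_def)
    have finJ: "finite (J t)" for t using bij_betw_finite[OF gJ] fin by blast
    define \<theta> where "\<theta> t v = (\<Sum>\<alpha>\<in>J t. vscale (v \<alpha>) (g \<alpha> t))" for t v
    have gM: "g \<alpha> t \<in> pm_space M t" if "\<alpha> \<in> A" for \<alpha> t using S(1)[OF gS[OF that]] bar_mem by blast
    have lin: "linear_between (pm_space (interval_sum A I) t) (pm_space M t) (\<theta> t)" for t
      unfolding linear_between_def
    proof (intro conjI ballI allI)
      show "\<theta> t \<in> pm_space (interval_sum A I) t \<rightarrow> pm_space M t"
        unfolding \<theta>_def using gM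
        by (intro Pi_I vec.subspace_sum vec.subspace_scale pm_subspace[OF M]) (auto simp: J_def)
      show "\<theta> t (u + v) = \<theta> t u + \<theta> t v" for u v
        unfolding \<theta>_def by (simp only: plus_fun_apply vec.scale_left_distrib sum.distrib)
      show "\<theta> t (vscale c u) = vscale c (\<theta> t u)" for c u
        unfolding \<theta>_def vec.scale_sum_right vec.scale_scale by (simp only: vscale_def)
    qed
    have supp: "v \<alpha> = 0" if "v \<in> pm_space (interval_sum A I) t" "\<alpha> \<notin> J t" for v \<alpha> t
      using that by (auto simp: interval_sum_mem_iff J_def)
    have reindex: "(\<Sum>b\<in>basis_at S t. vscale (c b) b) = \<theta> t (\<lambda>\<alpha>. if \<alpha> \<in> J t then c (g \<alpha> t) else 0)" for c t
      unfolding \<theta>_def by (simp add: sum.reindex_bij_betw[OF bij, symmetric])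
    have inj: "inj_on (\<theta> t) (pm_space (interval_sum A I) t)" for t
    proof (rule inj_onI)
      let ?V = "pm_space (interval_sum A I) t"
      fix u v assume uv: "u \<in> ?V" "v \<in> ?V" "\<theta> t u = \<theta> t v"
      define w where "w = u - v"
      have wV: "w \<in> ?V" unfolding w_def by (rule vec.subspace_diff[OF interval_sum_subspace uv(1,2)])
      have w0: "\<theta> t w = 0" unfolding w_def using linear_between_diff[OF lin interval_sum_subspace uv(1,2)] uv(3) by simp
      define c where "c b = w (inv_into (J t) (\<lambda>\<alpha>. g \<alpha> t) b)" for b
      have c: "c (g \<alpha> t) = w \<alpha>" if "\<alpha> \<in> J t" for \<alpha>
        unfolding c_def using bij_betw_inv_into_left[OF bij that] by simp
      have "(\<lambda>\<alpha>. if \<alpha> \<in> J t then c (g \<alpha> t) else 0) = w"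
        using c supp[OF wV] by (auto simp: fun_eq_iff)
      then have "(\<Sum>b\<in>basis_at S t. vscale (c b) b) = 0" using reindex[of c t] w0 by simp
      then have "c b = 0" if "b \<in> basis_at S t" for b
        using vec.independentD[OF S(3) finB order_refl _ that] by blast
      then have "w \<alpha> = 0" if "\<alpha> \<in> J t" for \<alpha>
        using c[OF that] bij_betwE[OF bij] that by metis
      then have "w = 0" using supp[OF wV] by (auto simp: fun_eq_iff)
      then show "u = v" unfolding w_def by (rule eq_iff_diff_eq_0[THEN iffD2])
    qed
    have "\<theta> t ` pm_space (interval_sum A I) t = pm_space M t" for t
    proof
      show "\<theta> t ` pm_space (interval_sum A I) t \<subseteq> pm_space M t"
        using linear_between_mem[OF lin] by blast
      show "pm_space M t \<subseteq> \<theta> t ` pm_space (interval_sum A I) t"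
      proof
        fix z assume "z \<in> pm_space M t"
        then obtain c where "z = (\<Sum>b\<in>basis_at S t. vscale (c b) b)"
          using S(4)[of t] unfolding vec.span_finite[OF finB] by blast
        then have "z = \<theta> t (\<lambda>\<alpha>. if \<alpha> \<in> J t then c (g \<alpha> t) else 0)" using reindex by simp
        moreover have "(\<lambda>\<alpha>. if \<alpha> \<in> J t then c (g \<alpha> t) else 0) \<in> pm_space (interval_sum A I) t"
        proof -
          have "{\<alpha>. (if \<alpha> \<in> J t then c (g \<alpha> t) else 0) \<noteq> 0} \<subseteq> J t" by auto
          then show ?thesis
            using finite_subset[OF _ finJ] by (auto simp: interval_sum_mem_iff J_def split: if_splits)
        qed
        ultimately show "z \<in> \<theta> t ` pm_space (interval_sum A I) t" by blast
      qed
    qed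
    with inj have "bij_betw (\<theta> t) (pm_space (interval_sum A I) t) (pm_space M t)" for t
      by (simp add: bij_betw_def)
    moreover have "\<theta> t (pm_map (interval_sum A I) s t v) = pm_map M s t (\<theta> s v)"
      if st: "s \<le> t" and v: "v \<in> pm_space (interval_sum A I) s" for s t v
    proof -
      have mem: "vscale (v \<alpha>) (g \<alpha> s) \<in> pm_space M s" if "\<alpha> \<in> J s" for \<alpha>
        using that gM by (intro vec.subspace_scale pm_subspace[OF M]) (simp add: J_def)
      have "pm_map M s t (\<theta> s v) = (\<Sum>\<alpha>\<in>J s. pm_map M s t (vscale (v \<alpha>) (g \<alpha> s)))"
        unfolding \<theta>_def by (rule linear_between_sum[OF pm_linear[OF M st] pm_subspace[OF M] mem])
      also have "\<dots> = (\<Sum>\<alpha>\<in>J s. vscale (v \<alpha>) (g \<alpha> t))"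
      proof (rule sum.cong[OF refl])
        fix \<alpha> assume \<alpha>: "\<alpha> \<in> J s"
        then have "\<alpha> \<in> A" "g \<alpha> s \<noteq> 0" by (auto simp: J_def I_def)
        then show "pm_map M s t (vscale (v \<alpha>) (g \<alpha> s)) = vscale (v \<alpha>) (g \<alpha> t)"
          using pm_scale[OF M st gM] bar_map[of M "g \<alpha>", OF _ st] S(1)[OF gS] by simp
      qed
      also have "\<dots> = (\<Sum>\<alpha>\<in>J s \<inter> J t. vscale (v \<alpha>) (g \<alpha> t))"
        using finJ by (intro sum.mono_neutral_right) (auto simp: J_def I_def)
      also have "\<dots> = (\<Sum>\<alpha>\<in>J t. vscale (pm_map (interval_sum A I) s t v \<alpha>) (g \<alpha> t))"
        using finJ by (intro sum.mono_neutral_cong_left) (auto simp: J_def I_def interval_sum_map)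
      finally show ?thesis unfolding \<theta>_def by simp
    qed
    ultimately show ?thesis
      unfolding isomorphic_def using lin by (intro exI[of _ \<theta>]) simp
  qed
  moreover have "persistence_module (interval_sum A I :: 'k pmod)"
    using calculation(1) by (intro persistence_module_interval_sum) (simp add: interval_def)
  ultimately show thesis using isomorphic_sym that by blast
qed

section \<open>Shrinking intervals\<close>

text \<open>
  For an interval \<open>J\<close> and \<open>t \<ge> 0\<close> this is \<open>J\<close> with a piece of length \<open>t\<close> cut off at the right end.
  It is empty once \<open>t\<close> exceeds the length, and the formula covers all types of
  endpoints and infinite intervals alike.
\<close>

definition shrink :: "real \<Rightarrow> real set \<Rightarrow> real set" where
  "shrink t J = {x \<in> J. x + t \<in> J}"

lemma is_interval_shrink:
  assumes "is_interval J"
  shows "is_interval (shrink t J)"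
  unfolding is_interval_1 shrink_def
proof (intro ballI allI impI)
  fix a b x assume "a \<in> {x \<in> J. x + t \<in> J}" "b \<in> {x \<in> J. x + t \<in> J}" "a \<le> x \<and> x \<le> b"
  then show "x \<in> {x \<in> J. x + t \<in> J}"
    using mem_is_interval_1_I[OF assms, of a b x] mem_is_interval_1_I[OF assms, of "a + t" "b + t" "x + t"]
    by simp
qed

lemma shrink_0 [simp]: "shrink 0 J = J"
  by (simp add: shrink_def)

text \<open>
  Restricting coefficients to those still allowed at the target commutes with the structure maps
  if, for each index, passing first along \<open>I\<close> or first to \<open>I'\<close> kills the same coefficients.
\<close>

lemma shift_morphism_truncate:
  assumes compat: "\<And>\<alpha> a b. \<alpha> \<in> A \<Longrightarrow> a \<le> b \<Longrightarrow> a \<in> I \<alpha> \<Longrightarrow> b + \<delta> \<in> I' \<alpha> \<Longrightarrow> b \<in> I \<alpha> \<longleftrightarrow> a + \<delta> \<in> I' \<alpha>"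
  shows "shift_morphism \<delta> (interval_sum A I :: 'k::field pmod) (interval_sum A I')
    (\<lambda>a v \<alpha>. if a + \<delta> \<in> I' \<alpha> then v \<alpha> else 0)"
  unfolding shift_morphism_def
proof (intro conjI allI ballI impI)
  let ?M = "interval_sum A I :: 'k pmod" and ?N = "interval_sum A I' :: 'k pmod"
  show "linear_between (pm_space ?M a) (pm_space ?N (a + \<delta>)) (\<lambda>v \<alpha>. if a + \<delta> \<in> I' \<alpha> then v \<alpha> else 0)" for a
    unfolding linear_between_def
  proof (intro conjI ballI allI)
    show "(\<lambda>v \<alpha>. if a + \<delta> \<in> I' \<alpha> then v \<alpha> else 0) \<in> pm_space ?M a \<rightarrow> pm_space ?N (a + \<delta>)"
    proof
      fix v assume "v \<in> pm_space ?M a"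
      then show "(\<lambda>\<alpha>. if a + \<delta> \<in> I' \<alpha> then v \<alpha> else 0) \<in> pm_space ?N (a + \<delta>)"
        by (rule interval_sum_truncate) (auto split: if_splits)
    qed
  qed (auto simp: fun_eq_iff vscale_def)
  show "(\<lambda>\<alpha>. if b + \<delta> \<in> I' \<alpha> then pm_map ?M a b v \<alpha> else 0) =
      pm_map ?N (a + \<delta>) (b + \<delta>) (\<lambda>\<alpha>. if a + \<delta> \<in> I' \<alpha> then v \<alpha> else 0)"
    if "a \<le> b" "v \<in> pm_space ?M a" for a b v
  proof
    fix \<alpha>
    show "(if b + \<delta> \<in> I' \<alpha> then pm_map ?M a b v \<alpha> else 0) =
      pm_map ?N (a + \<delta>) (b + \<delta>) (\<lambda>\<alpha>. if a + \<delta> \<in> I' \<alpha> then v \<alpha> else 0) \<alpha>"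
      using that compat[of \<alpha> a b] by (cases "v \<alpha> = 0") (auto simp: interval_sum_map interval_sum_mem_iff)
  qed
qed

lemma round_trip_truncate:
  assumes "\<And>\<alpha> a. \<alpha> \<in> A \<Longrightarrow> a \<in> I \<alpha> \<Longrightarrow> a + 2 * \<delta> \<in> I \<alpha> \<Longrightarrow> a + \<delta> \<in> I' \<alpha>"
  shows "round_trip \<delta> (interval_sum A I)
    (\<lambda>a v \<alpha>. if a + \<delta> \<in> I' \<alpha> then v \<alpha> else 0) (\<lambda>a v \<alpha>. if a + \<delta> \<in> I \<alpha> then v \<alpha> else 0)"
  unfolding round_trip_def
proof (intro allI ballI ext)
  have as: "a + \<delta> + \<delta> = a + 2 * \<delta>" for a by simp
  fix a v \<alpha> assume "v \<in> pm_space (interval_sum A I) a"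
  then show "(if a + \<delta> + \<delta> \<in> I \<alpha> then if a + \<delta> \<in> I' \<alpha> then v \<alpha> else 0 else 0) =
      pm_map (interval_sum A I) a (a + 2 * \<delta>) v \<alpha>"
    unfolding as using assms[of \<alpha> a]
    by (cases "v \<alpha> = 0") (auto simp: interval_sum_map interval_sum_mem_iff)
qed

lemma shrink_interleaved:
  assumes I: "\<And>\<alpha>. \<alpha> \<in> A \<Longrightarrow> is_interval (I \<alpha>)" and st: "0 \<le> s" "s \<le> t"
  shows "interleaved (t - s) (interval_sum A (\<lambda>\<alpha>. shrink s (I \<alpha>)) :: 'k::field pmod)
    (interval_sum A (\<lambda>\<alpha>. shrink t (I \<alpha>)))"
proof -
  define \<delta> where "\<delta> = t - s"
  have \<delta>: "0 \<le> \<delta>" "t = s + \<delta>" using st by (auto simp: \<delta>_def)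
  have conv: "x \<in> I \<alpha>" if "\<alpha> \<in> A" "a \<in> I \<alpha>" "b \<in> I \<alpha>" "a \<le> x" "x \<le> b" for \<alpha> a b x
    using mem_is_interval_1_I[OF I[OF that(1)] that(2-5)] .
  have 1: "b \<in> shrink s (I \<alpha>) \<longleftrightarrow> a + \<delta> \<in> shrink t (I \<alpha>)"
    if "\<alpha> \<in> A" "a \<le> b" "a \<in> shrink s (I \<alpha>)" "b + \<delta> \<in> shrink t (I \<alpha>)" for \<alpha> a b
    using that st \<delta> conv[of \<alpha> a "b + \<delta> + t"] by (auto simp: shrink_def)
  have 2: "b \<in> shrink t (I \<alpha>) \<longleftrightarrow> a + \<delta> \<in> shrink s (I \<alpha>)"
    if "\<alpha> \<in> A" "a \<le> b" "a \<in> shrink t (I \<alpha>)" "b + \<delta> \<in> shrink s (I \<alpha>)" for \<alpha> a b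
    using that st \<delta> conv[of \<alpha> a "b + \<delta>"] by (auto simp: shrink_def algebra_simps)
  have 3: "a + \<delta> \<in> shrink t (I \<alpha>)"
    if "\<alpha> \<in> A" "a \<in> shrink s (I \<alpha>)" "a + 2 * \<delta> \<in> shrink s (I \<alpha>)" for \<alpha> a
    using that st \<delta> conv[of \<alpha> a "a + 2 * \<delta>"] by (auto simp: shrink_def algebra_simps)
  have 4: "a + \<delta> \<in> shrink s (I \<alpha>)"
    if "\<alpha> \<in> A" "a \<in> shrink t (I \<alpha>)" "a + 2 * \<delta> \<in> shrink t (I \<alpha>)" for \<alpha> a
    using that st \<delta> conv[of \<alpha> a "a + 2 * \<delta>"] by (auto simp: shrink_def algebra_simps)
  show ?thesis
    unfolding interleaved_iff \<delta>_def[symmetric]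
  proof (intro exI conjI)
    show "shift_morphism \<delta> (interval_sum A (\<lambda>\<alpha>. shrink s (I \<alpha>)) :: 'k pmod)
        (interval_sum A (\<lambda>\<alpha>. shrink t (I \<alpha>))) (\<lambda>a v \<alpha>. if a + \<delta> \<in> shrink t (I \<alpha>) then v \<alpha> else 0)"
      by (rule shift_morphism_truncate[OF 1])
    show "shift_morphism \<delta> (interval_sum A (\<lambda>\<alpha>. shrink t (I \<alpha>)) :: 'k pmod)
        (interval_sum A (\<lambda>\<alpha>. shrink s (I \<alpha>))) (\<lambda>a v \<alpha>. if a + \<delta> \<in> shrink s (I \<alpha>) then v \<alpha> else 0)"
      by (rule shift_morphism_truncate[OF 2])
    show "round_trip \<delta> (interval_sum A (\<lambda>\<alpha>. shrink s (I \<alpha>)) :: 'k pmod)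
       (\<lambda>a v \<alpha>. if a + \<delta> \<in> shrink t (I \<alpha>) then v \<alpha> else 0) (\<lambda>a v \<alpha>. if a + \<delta> \<in> shrink s (I \<alpha>) then v \<alpha> else 0)"
      by (rule round_trip_truncate[OF 3])
    show "round_trip \<delta> (interval_sum A (\<lambda>\<alpha>. shrink t (I \<alpha>)) :: 'k pmod)
       (\<lambda>a v \<alpha>. if a + \<delta> \<in> shrink s (I \<alpha>) then v \<alpha> else 0) (\<lambda>a v \<alpha>. if a + \<delta> \<in> shrink t (I \<alpha>) then v \<alpha> else 0)"
      by (rule round_trip_truncate[OF 4])
  qed
qed

lemma interval_length_le:
  assumes "interval J" "shrink L J = {}" "0 \<le> L"
  shows "interval_length J \<le> ereal L"
proof -
  have J: "is_interval J" "J \<noteq> {}" using assms(1) by (auto simp: interval_def)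
  have le: "y \<le> x + L" if "x \<in> J" "y \<in> J" for x y
  proof (rule ccontr)
    assume "\<not> y \<le> x + L"
    then have "x + L \<in> J" using mem_is_interval_1_I[OF J(1) that, of "x + L"] assms(3) by simp
    then show False using that(1) assms(2) by (auto simp: shrink_def)
  qed
  have "Sup (ereal ` J) \<le> ereal x + ereal L" if "x \<in> J" for x
    using le[OF that] by (auto intro!: Sup_least)
  then have "Sup (ereal ` J) - ereal L \<le> ereal x" if "x \<in> J" for x
    using that by (simp add: ereal_minus_le)
  then have "Sup (ereal ` J) - ereal L \<le> Inf (ereal ` J)"
    by (auto intro!: Inf_greatest)
  then have *: "Sup (ereal ` J) \<le> Inf (ereal ` J) + ereal L" by (simp add: ereal_minus_le)
  obtain x where x: "x \<in> J" using J(2) by blast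
  have "Inf (ereal ` J) \<le> ereal x" using x by (auto intro: Inf_lower)
  moreover have "ereal x \<le> Sup (ereal ` J)" using x by (auto intro: Sup_upper)
  ultimately show ?thesis
    using * unfolding interval_length_def
    by (cases "Inf (ereal ` J)"; cases "Sup (ereal ` J)") auto
qed

lemma shrink_empty:
  assumes "interval_length J < ereal L"
  shows "shrink L J = {}"
proof (rule ccontr)
  assume "shrink L J \<noteq> {}"
  then obtain x where x: "x \<in> J" "x + L \<in> J" by (auto simp: shrink_def)
  have "Inf (ereal ` J) \<le> ereal x" using x by (auto intro: Inf_lower)
  moreover have "ereal (x + L) \<le> Sup (ereal ` J)" using x by (intro Sup_upper imageI)
  ultimately show False
    using assms unfolding interval_length_def
    by (cases "Inf (ereal ` J)"; cases "Sup (ereal ` J)") auto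
qed

section \<open>Modules whose long structure maps vanish\<close>

definition vanishes_after :: "real \<Rightarrow> 'k::field pmod \<Rightarrow> bool" where
  "vanishes_after L M \<longleftrightarrow> (\<forall>a. \<forall>x\<in>pm_space M a. pm_map M a (a + L) x = 0)"

lemma vanishes_after_isomorphic:
  assumes M: "persistence_module M" and "isomorphic M N" and "vanishes_after L M" "0 \<le> L"
  shows "vanishes_after L N"
proof -
  obtain \<theta> where \<theta>: "shift_morphism 0 M N \<theta>" "\<And>a. bij_betw (\<theta> a) (pm_space M a) (pm_space N a)"
    using assms(2) unfolding isomorphic_iff by blast
  have "pm_map N a (a + L) y = 0" if y: "y \<in> pm_space N a" for a y
  proof -
    obtain x where x: "x \<in> pm_space M a" "y = \<theta> a x" using y bij_betw_imp_surj_on[OF \<theta>(2)] by blast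
    have "pm_map N a (a + L) y = \<theta> (a + L) (pm_map M a (a + L) x)"
      using shift_morphism_natural[OF \<theta>(1) _ x(1), of "a + L"] assms(4) x(2) by simp
    also have "pm_map M a (a + L) x = 0" using assms(3) x(1) by (simp add: vanishes_after_def)
    also have "\<theta> (a + L) 0 = 0"
      using linear_between_zero[OF shift_morphism_linear[OF \<theta>(1)] pm_subspace[OF M]] .
    finally show ?thesis .
  qed
  then show ?thesis by (simp add: vanishes_after_def)
qed

lemma vanishes_after_interval_sum_iff:
  "vanishes_after L (interval_sum A I :: 'k::field pmod) \<longleftrightarrow> (\<forall>\<alpha>\<in>A. shrink L (I \<alpha>) = {})"
proof
  assume van: "vanishes_after L (interval_sum A I :: 'k pmod)"
  show "\<forall>\<alpha>\<in>A. shrink L (I \<alpha>) = {}"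
  proof (intro ballI equals0I)
    fix \<alpha> x assume \<alpha>: "\<alpha> \<in> A" and x: "x \<in> shrink L (I \<alpha>)"
    define v :: "real \<Rightarrow> 'k" where "v = (\<lambda>\<beta>. if \<beta> = \<alpha> then 1 else 0)"
    have "v \<in> pm_space (interval_sum A I) x"
      using \<alpha> x by (simp add: v_def interval_sum_mem_iff shrink_def)
    then have "pm_map (interval_sum A I) x (x + L) v \<alpha> = 0"
      using van by (simp add: vanishes_after_def)
    then show False using x by (simp add: interval_sum_map shrink_def v_def)
  qed
next
  assume "\<forall>\<alpha>\<in>A. shrink L (I \<alpha>) = {}"
  then show "vanishes_after L (interval_sum A I :: 'k pmod)"
    by (force simp: vanishes_after_def interval_sum_map interval_sum_mem_iff shrink_def fun_eq_iff)
qed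

lemma persistence_module_zero: "persistence_module zero_module"
  by (simp add: persistence_module_def zero_module_def linear_between_def)

lemma zero_module_isomorphic:
  assumes "\<And>\<alpha>. \<alpha> \<in> A \<Longrightarrow> I \<alpha> = {}"
  shows "isomorphic zero_module (interval_sum A I :: 'k::field pmod)"
proof -
  have "pm_space (interval_sum A I :: 'k pmod) t = {0}" for t
  proof -
    have "w \<alpha> = 0" if "w \<in> pm_space (interval_sum A I :: 'k pmod) t" for w \<alpha>
      using that assms[of \<alpha>] by (auto simp: interval_sum_mem_iff)
    then have "pm_space (interval_sum A I :: 'k pmod) t \<subseteq> {0}"
      by (force simp: fun_eq_iff)
    then show ?thesis using vec.subspace_0[OF interval_sum_subspace] by blast
  qed
  then show ?thesis
    unfolding isomorphic_def
    by (intro exI[of _ "\<lambda>a x. x"])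
      (auto simp: zero_module_def linear_between_def bij_betw_def interval_sum_map fun_eq_iff)
qed

text \<open>
  The structure map over \<open>2\<epsilon>\<close> is a round trip through the zero module.
\<close>

lemma interleaved_zero_vanishes:
  assumes "interleaved \<epsilon> zero_module M"
  shows "vanishes_after (2 * \<epsilon>) M"
proof -
  obtain \<phi> \<psi> where \<phi>: "shift_morphism \<epsilon> zero_module M \<phi>" and \<psi>: "shift_morphism \<epsilon> M zero_module \<psi>"
    and rt: "round_trip \<epsilon> M \<psi> \<phi>"
    using assms unfolding interleaved_iff by blast
  have "pm_map M a (a + 2 * \<epsilon>) x = 0" if x: "x \<in> pm_space M a" for a x
  proof -
    have "\<psi> a x = 0" using shift_morphism_mem[OF \<psi> x] by (simp add: zero_module_def)
    moreover have "\<phi> (a + \<epsilon>) 0 = 0"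
      using linear_between_zero[OF shift_morphism_linear[OF \<phi>] pm_subspace[OF persistence_module_zero]] .
    ultimately show ?thesis using rt x by (metis round_trip_def)
  qed
  then show ?thesis by (simp add: vanishes_after_def)
qed

section \<open>The three spaces\<close>

lemma pfd_finite_dim:
  assumes "M \<in> pfd"
  shows "finite_dim (pm_space M a)"
proof -
  obtain B where "finite B" "vec.span B = pm_space M a" using assms by (auto simp: pfd_def)
  then show ?thesis unfolding finite_dim_def by blast
qed

lemma zero_module_mem:
  assumes "X \<in> {cfid, pfd, rid}"
  shows "zero_module \<in> X"
proof -
  have iso: "isomorphic zero_module (interval_sum {} (\<lambda>_. {}))" by (rule zero_module_isomorphic) simp
  have "zero_module \<in> cfid"
    unfolding cfid_def using persistence_module_zero iso countable_empty by blast
  moreover have "zero_module \<in> pfd"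
    unfolding pfd_def using persistence_module_zero vec.span_empty
    by (auto simp: zero_module_def intro!: exI[of _ "{}"])
  moreover have "zero_module \<in> rid"
    unfolding rid_def using persistence_module_zero iso by blast
  ultimately show ?thesis using assms by blast
qed

text \<open>
  A countable decomposition comes with the membership in \<open>cfid\<close>.  It is recorded because another
  given decomposition of the same module is not known to be countable without a uniqueness theorem.
\<close>

lemma interval_decomposition:
  assumes "X \<in> {cfid, pfd, rid}" "M \<in> X"
  shows "\<exists>A I. (\<forall>\<alpha>\<in>A. interval (I \<alpha>)) \<and> isomorphic M (interval_sum A I) \<and> (X = cfid \<longrightarrow> countable A)"
proof (cases "X = cfid")
  case True
  then show ?thesis using assms(2) unfolding cfid_def by blast
next
  case False
  have "\<exists>A I. (\<forall>\<alpha>\<in>A. interval (I \<alpha>)) \<and> isomorphic M (interval_sum A I)"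
  proof (cases "X = rid")
    case True
    then show ?thesis using assms(2) unfolding rid_def by blast
  next
    assume "X \<noteq> rid"
    with False have M: "M \<in> pfd" using assms by blast
    then have "persistence_module M" by (simp add: pfd_def)
    then obtain A I where "\<And>\<alpha>. \<alpha> \<in> A \<Longrightarrow> interval (I \<alpha>)" "isomorphic M (interval_sum A I)"
      using pfd_interval_decomposition[OF _ pfd_finite_dim[OF M]] by blast
    then show ?thesis by blast
  qed
  with False show ?thesis by blast
qed

text \<open>
  Shrinking may leave empty sets, which are not intervals; they contribute nothing to the sum.
\<close>

lemma interval_sum_nonempty_intervals:
  "interval_sum A I = interval_sum {\<alpha> \<in> A. I \<alpha> \<noteq> {}} I"
proof -
  have "pm_space (interval_sum A I) = pm_space (interval_sum {\<alpha> \<in> A. I \<alpha> \<noteq> {}} I)"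
    unfolding fun_eq_iff set_eq_iff interval_sum_mem_iff by blast
  then show ?thesis by (simp add: interval_sum_def)
qed

text \<open>
  In \<open>cfid\<close> the bound \<open>L\<close> keeps the intervals bounded; in \<open>pfd\<close> the spaces of the shrunk sum
  are contained in those of the original one.
\<close>

lemma shrink_mem:
  fixes M :: "'k::field pmod"
  assumes X: "X \<in> {cfid, pfd, rid}" "M \<in> X"
    and I: "\<And>\<alpha>. \<alpha> \<in> A \<Longrightarrow> interval (I \<alpha>)" and iso: "isomorphic M (interval_sum A I)"
    and count: "X = cfid \<Longrightarrow> countable A" and short: "\<And>\<alpha>. \<alpha> \<in> A \<Longrightarrow> shrink L (I \<alpha>) = {}" "0 \<le> L"
  shows "interval_sum A (\<lambda>\<alpha>. shrink t (I \<alpha>)) \<in> X"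
proof -
  let ?N = "interval_sum A (\<lambda>\<alpha>. shrink t (I \<alpha>)) :: 'k pmod"
  define A' where "A' = {\<alpha> \<in> A. shrink t (I \<alpha>) \<noteq> {}}"
  have N: "persistence_module ?N"
    using I by (intro persistence_module_interval_sum is_interval_shrink) (simp add: interval_def)
  have int: "interval (shrink t (I \<alpha>))" if "\<alpha> \<in> A'" for \<alpha>
    using that I is_interval_shrink by (auto simp: A'_def interval_def)
  have isoN: "isomorphic ?N (interval_sum A' (\<lambda>\<alpha>. shrink t (I \<alpha>)))"
    unfolding A'_def using isomorphic_refl interval_sum_nonempty_intervals by metis
  consider "X = cfid" | "X = pfd" | "X = rid" using X(1) by blast
  then show ?thesis
  proof cases
    case 1
    have bdd: "bounded (shrink t (I \<alpha>))" if "\<alpha> \<in> A'" for \<alpha>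
    proof -
      have \<alpha>: "\<alpha> \<in> A" using that by (simp add: A'_def)
      then obtain x where x: "x \<in> I \<alpha>" using I by (auto simp: interval_def)
      have "y \<in> {x - L..x + L}" if y: "y \<in> I \<alpha>" for y
      proof (rule ccontr)
        have J: "is_interval (I \<alpha>)" using I[OF \<alpha>] by (simp add: interval_def)
        assume "y \<notin> {x - L..x + L}"
        then consider "y + L < x" | "x + L < y" by force
        then have "y + L \<in> I \<alpha> \<or> x + L \<in> I \<alpha>"
          using mem_is_interval_1_I[OF J y x, of "y + L"] mem_is_interval_1_I[OF J x y, of "x + L"] short(2)
          by cases auto
        then show False using short(1)[OF \<alpha>] x y by (auto simp: shrink_def)
      qed
      then have "shrink t (I \<alpha>) \<subseteq> {x - L..x + L}" unfolding shrink_def by blast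
      then show ?thesis using bounded_closed_interval bounded_subset by blast
    qed
    have "countable A'" using count[OF 1] by (simp add: A'_def)
    then have "?N \<in> cfid"
      unfolding cfid_def mem_Collect_eq
      by (intro conjI N exI[of _ A'] exI[of _ "\<lambda>\<alpha>. shrink t (I \<alpha>)"] ballI int bdd isoN)
    then show ?thesis using 1 by simp
  next
    case 2
    have "\<exists>B. finite B \<and> vec.span B = pm_space ?N a" for a
    proof -
      obtain \<theta> where \<theta>: "shift_morphism 0 M (interval_sum A I) \<theta>"
        "\<And>a. bij_betw (\<theta> a) (pm_space M a) (pm_space (interval_sum A I) a)"
        using iso unfolding isomorphic_iff by blast
      have "persistence_module M" "finite_dim (pm_space M a)"
        using X(2) 2 pfd_finite_dim by (auto simp: pfd_def)
      then have "finite_dim (\<theta> a ` pm_space M a)"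
        using finite_dim_linear_image[OF _ pm_subspace shift_morphism_linear[OF \<theta>(1)]] by blast
      moreover have "pm_space ?N a \<subseteq> \<theta> a ` pm_space M a"
        unfolding bij_betw_imp_surj_on[OF \<theta>(2)] by (auto simp: interval_sum_mem_iff shrink_def)
      ultimately have "finite_dim (pm_space ?N a)" by (rule finite_dim_subset)
      then show ?thesis using finite_dim_spanned_exactly[OF _ interval_sum_subspace] by metis
    qed
    then have "?N \<in> pfd" unfolding pfd_def using N by blast
    then show ?thesis using 2 by simp
  next
    case 3
    have "?N \<in> rid"
      unfolding rid_def mem_Collect_eq
      by (intro conjI N exI[of _ A'] exI[of _ "\<lambda>\<alpha>. shrink t (I \<alpha>)"] ballI int isoN)
    then show ?thesis using 3 by simp
  qed
qed

section \<open>The topology\<close>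

lemma class_in_ball_iff:
  assumes X: "\<forall>N\<in>X. persistence_module N" and MN: "M \<in> X" "N \<in> X"
  shows "iso_class N \<in> interleaving_ball X M r \<longleftrightarrow> (\<exists>\<epsilon>\<ge>0. \<epsilon> < r \<and> interleaved \<epsilon> M N)"
proof
  assume "iso_class N \<in> interleaving_ball X M r"
  then obtain N' \<epsilon> where N': "N' \<in> X" "iso_class N = iso_class N'" "0 \<le> \<epsilon>" "\<epsilon> < r" "interleaved \<epsilon> M N'"
    by (auto simp: interleaving_ball_def interleaving_distance_less_iff)
  have pm: "persistence_module M" "persistence_module N" "persistence_module N'"
    using X MN N'(1) by auto
  have "isomorphic N' N" using N'(2) iso_class_eq_iff[OF pm(3,2)] by simp
  then have "interleaved (\<epsilon> + 0) M N"
    using isomorphic_interleaved[OF pm(3,2)] interleaved_trans[OF pm(1,2) N'(3) order_refl N'(5)] by blast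
  then show "\<exists>\<epsilon>\<ge>0. \<epsilon> < r \<and> interleaved \<epsilon> M N" using N'(3,4) by auto
next
  assume "\<exists>\<epsilon>\<ge>0. \<epsilon> < r \<and> interleaved \<epsilon> M N"
  then show "iso_class N \<in> interleaving_ball X M r"
    using MN by (auto simp: interleaving_ball_def interleaving_distance_less_iff)
qed

lemma self_interleaved: "persistence_module M \<Longrightarrow> interleaved 0 M M"
  using isomorphic_interleaved isomorphic_refl by blast

lemma openin_ball: "M \<in> X \<Longrightarrow> 0 < r \<Longrightarrow> openin (interleaving_topology X) (interleaving_ball X M r)"
  unfolding interleaving_topology_def by (rule topology_generated_by_Basis) blast

lemma topspace_interleaving:
  assumes X: "\<forall>N\<in>X. persistence_module N"
  shows "topspace (interleaving_topology X) = iso_class ` X"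
proof
  show "topspace (interleaving_topology X) \<subseteq> iso_class ` X"
    by (auto simp: interleaving_topology_def interleaving_ball_def)
  show "iso_class ` X \<subseteq> topspace (interleaving_topology X)"
  proof
    fix c assume "c \<in> iso_class ` X"
    then obtain M where M: "M \<in> X" "c = iso_class M" by blast
    then have "c \<in> interleaving_ball X M 1"
      using class_in_ball_iff[OF X M(1) M(1)] self_interleaved[OF bspec[OF X M(1)]] by force
    then show "c \<in> topspace (interleaving_topology X)"
      using openin_subset[OF openin_ball[OF M(1), of 1]] by auto
  qed
qed

text \<open>
  A set of modules closed under finite interleaving distance is a union of balls of radius \<open>1\<close>,
  hence open.  This applies to the modules at finite distance from \<open>M0\<close> and to all others, so the
  former form an open and closed set, which a path cannot leave.
\<close>

lemma path_component_imp_interleaved: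
  assumes X: "\<forall>N\<in>X. persistence_module N" and M0: "M0 \<in> X"
    and path: "path_component_of (interleaving_topology X) (iso_class M0) c"
  obtains M \<epsilon> where "M \<in> X" "c = iso_class M" "0 \<le> \<epsilon>" "interleaved \<epsilon> M0 M"
proof -
  define near where "near M \<longleftrightarrow> (\<exists>\<epsilon>\<ge>0. interleaved \<epsilon> M0 M)" for M
  have near_cong: "near N" if "near M" "M \<in> X" "N \<in> X" "0 \<le> \<delta>" "interleaved \<delta> M N" for M N \<delta>
  proof -
    obtain \<epsilon> where "0 \<le> \<epsilon>" "interleaved \<epsilon> M0 M" using \<open>near M\<close> by (auto simp: near_def)
    then have "0 \<le> \<epsilon> + \<delta>" "interleaved (\<epsilon> + \<delta>) M0 N"
      using interleaved_trans[OF bspec[OF X M0] bspec[OF X that(3)]] that(4,5) by auto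
    then show ?thesis by (auto simp: near_def)
  qed
  have open_class: "openin (interleaving_topology X) (iso_class ` {M \<in> X. P M})"
    if P: "\<And>M N \<delta>. P M \<Longrightarrow> M \<in> X \<Longrightarrow> N \<in> X \<Longrightarrow> 0 \<le> \<delta> \<Longrightarrow> interleaved \<delta> M N \<Longrightarrow> P N" for P
  proof -
    have "iso_class ` {M \<in> X. P M} = (\<Union>M\<in>{M \<in> X. P M}. interleaving_ball X M 1)"
    proof (intro equalityI subsetI)
      fix c assume "c \<in> iso_class ` {M \<in> X. P M}"
      then obtain M where M: "M \<in> X" "P M" "c = iso_class M" by blast
      have "c \<in> interleaving_ball X M 1"
        unfolding M(3) class_in_ball_iff[OF X M(1) M(1)] using self_interleaved[OF bspec[OF X M(1)]] by force
      then show "c \<in> (\<Union>M\<in>{M \<in> X. P M}. interleaving_ball X M 1)" using M by blast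
    next
      fix c assume "c \<in> (\<Union>M\<in>{M \<in> X. P M}. interleaving_ball X M 1)"
      then obtain M N \<epsilon> where "M \<in> X" "P M" "N \<in> X" "c = iso_class N" "0 \<le> \<epsilon>" "interleaved \<epsilon> M N"
        by (auto simp: interleaving_ball_def interleaving_distance_less_iff)
      then show "c \<in> iso_class ` {M \<in> X. P M}" using P by blast
    qed
    moreover have "openin (interleaving_topology X) (\<Union>M\<in>{M \<in> X. P M}. interleaving_ball X M 1)"
      by (intro openin_Union) (auto intro: openin_ball)
    ultimately show ?thesis by simp
  qed
  define T where "T = iso_class ` {M \<in> X. near M}"
  have "openin (interleaving_topology X) T"
    unfolding T_def by (rule open_class) (rule near_cong)
  moreover have "closedin (interleaving_topology X) T"
  proof -
    have "topspace (interleaving_topology X) - T = iso_class ` {M \<in> X. \<not> near M}"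
    proof (intro equalityI subsetI)
      fix c assume "c \<in> topspace (interleaving_topology X) - T"
      then show "c \<in> iso_class ` {M \<in> X. \<not> near M}"
        unfolding topspace_interleaving[OF X] T_def by blast
    next
      fix c assume "c \<in> iso_class ` {M \<in> X. \<not> near M}"
      then obtain M where M: "M \<in> X" "\<not> near M" "c = iso_class M" by blast
      have "c \<notin> T"
      proof
        assume "c \<in> T"
        then obtain N where N: "N \<in> X" "near N" "iso_class N = iso_class M" using M(3) by (auto simp: T_def)
        then have "interleaved 0 N M"
          using iso_class_eq_iff isomorphic_interleaved X M(1) by blast
        then show False using near_cong N(1,2) M(1,2) by blast
      qed
      then show "c \<in> topspace (interleaving_topology X) - T"
        unfolding topspace_interleaving[OF X] using M by blast
    qed
    moreover have "openin (interleaving_topology X) (iso_class ` {M \<in> X. \<not> near M})"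
      by (rule open_class) (use near_cong interleaved_sym in blast)
    moreover have "T \<subseteq> topspace (interleaving_topology X)"
      unfolding topspace_interleaving[OF X] T_def by blast
    ultimately show ?thesis by (simp add: closedin_def)
  qed
  moreover have "iso_class M0 \<in> T"
    unfolding T_def near_def using M0 self_interleaved[OF bspec[OF X M0]] by blast
  ultimately have "c \<in> T"
    using path_imp_quasi_component_of[OF path] unfolding quasi_component_of_def by blast
  then show thesis using that unfolding T_def near_def by blast
qed

lemma path_of_Lipschitz:
  fixes N :: "real \<Rightarrow> 'k::field pmod"
  assumes X: "\<forall>N\<in>X. persistence_module N" and L: "0 \<le> L"
    and NX: "\<And>\<tau>. 0 \<le> \<tau> \<Longrightarrow> N \<tau> \<in> X"
    and lip: "\<And>\<sigma> \<tau>. 0 \<le> \<sigma> \<Longrightarrow> \<sigma> \<le> \<tau> \<Longrightarrow> interleaved (L * (\<tau> - \<sigma>)) (N \<sigma>) (N \<tau>)"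
  shows "path_component_of (interleaving_topology X) (iso_class (N 0)) (iso_class (N 1))"
  unfolding path_component_of_def pathin_def
proof (intro exI[of _ "\<lambda>\<tau>. iso_class (N \<tau>)"] conjI refl)
  have lip': "interleaved (L * \<bar>\<tau> - \<sigma>\<bar>) (N \<sigma>) (N \<tau>)" if "0 \<le> \<sigma>" "0 \<le> \<tau>" for \<sigma> \<tau>
    using lip[of \<sigma> \<tau>] interleaved_sym[OF lip[of \<tau> \<sigma>]] that by (cases "\<sigma> \<le> \<tau>") (auto simp: abs_if)
  show "continuous_map (top_of_set {0..1}) (interleaving_topology X) (\<lambda>\<tau>. iso_class (N \<tau>))"
    unfolding interleaving_topology_def
  proof (rule continuous_on_generated_topo)
    fix U assume "U \<in> {interleaving_ball X M r |M r. M \<in> X \<and> 0 < r}"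
    then obtain M r where M: "M \<in> X" and U: "U = interleaving_ball X M r" by blast
    define W where "W = {\<tau> \<in> {0..1}. \<exists>\<epsilon>\<ge>0. \<epsilon> < r \<and> interleaved \<epsilon> M (N \<tau>)}"
    have "(\<lambda>\<tau>. iso_class (N \<tau>)) -` U \<inter> topspace (top_of_set {0..1}) = W"
      using class_in_ball_iff[OF X M NX] by (auto simp: U W_def)
    moreover have "openin (top_of_set {0..1}) W"
      unfolding openin_euclidean_subtopology_iff
    proof (intro conjI ballI)
      show "W \<subseteq> {0..1}" by (auto simp: W_def)
      fix \<tau> assume "\<tau> \<in> W"
      then obtain \<epsilon> where \<epsilon>: "0 \<le> \<tau>" "0 \<le> \<epsilon>" "\<epsilon> < r" "interleaved \<epsilon> M (N \<tau>)" by (auto simp: W_def)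
      show "\<exists>e>0. \<forall>\<sigma>\<in>{0..1}. dist \<sigma> \<tau> < e \<longrightarrow> \<sigma> \<in> W"
      proof (intro exI[of _ "(r - \<epsilon>) / (L + 1)"] conjI ballI impI)
        show "0 < (r - \<epsilon>) / (L + 1)" using \<epsilon> L by simp
        fix \<sigma> :: real assume \<sigma>: "\<sigma> \<in> {0..1}" "dist \<sigma> \<tau> < (r - \<epsilon>) / (L + 1)"
        have "\<bar>\<sigma> - \<tau>\<bar> * (L + 1) < r - \<epsilon>" using \<sigma>(2) L by (simp add: dist_real_def pos_less_divide_eq)
        then have less: "\<epsilon> + L * \<bar>\<sigma> - \<tau>\<bar> < r" by (simp add: algebra_simps)
        have "0 \<le> L * \<bar>\<sigma> - \<tau>\<bar>" using L by simp
        moreover from this have "interleaved (\<epsilon> + L * \<bar>\<sigma> - \<tau>\<bar>) M (N \<sigma>)"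
          using \<sigma>(1) \<epsilon> by (intro interleaved_trans[OF bspec[OF X M] bspec[OF X NX] \<epsilon>(2) _ \<epsilon>(4)] lip') auto
        ultimately show "\<sigma> \<in> W" using \<sigma>(1) \<epsilon>(2) less by (auto simp: W_def intro!: exI[of _ "\<epsilon> + L * \<bar>\<sigma> - \<tau>\<bar>"])
      qed
    qed
    ultimately show "openin (top_of_set {0..1}) ((\<lambda>\<tau>. iso_class (N \<tau>)) -` U \<inter> topspace (top_of_set {0..1}))"
      by simp
  next
    have "(\<lambda>\<tau>. iso_class (N \<tau>)) ` {0..1} \<subseteq> topspace (interleaving_topology X)"
      unfolding topspace_interleaving[OF X] using NX by auto
    then show "(\<lambda>\<tau>. iso_class (N \<tau>)) ` topspace (top_of_set {0..1}) \<subseteq>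
        \<Union> {interleaving_ball X M r |M r. M \<in> X \<and> 0 < r}"
      by (simp add: interleaving_topology_def)
  qed
qed

theorem proposition4p16:
  fixes X :: "'k::field pmod set"
  assumes "X \<in> {cfid, pfd, rid}"
  shows "path_component_of_set (interleaving_topology X) (iso_class zero_module) =
    iso_class ` {M \<in> X. \<exists>A I. (\<forall>\<alpha>\<in>A. interval (I \<alpha>)) \<and> isomorphic M (interval_sum A I) \<and>
                          (SUP \<alpha>\<in>A. interval_length (I \<alpha>)) < \<infinity>}"
proof (intro equalityI subsetI)
  have X: "\<forall>N\<in>X. persistence_module N" using assms by (auto simp: cfid_def pfd_def rid_def)
  fix c assume "c \<in> path_component_of_set (interleaving_topology X) (iso_class zero_module)"
  then obtain M \<epsilon> where M: "M \<in> X" "c = iso_class M" and \<epsilon>: "0 \<le> \<epsilon>" "interleaved \<epsilon> zero_module M"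
    using path_component_imp_interleaved[OF X zero_module_mem[OF assms]] by blast
  obtain A I where I: "\<forall>\<alpha>\<in>A. interval (I \<alpha>)" and iso: "isomorphic M (interval_sum A I)"
    using interval_decomposition[OF assms M(1)] by blast
  have "vanishes_after (2 * \<epsilon>) (interval_sum A I :: 'k pmod)"
    using vanishes_after_isomorphic[OF bspec[OF X M(1)] iso interleaved_zero_vanishes[OF \<epsilon>(2)]] \<epsilon>(1) by simp
  then have "interval_length (I \<alpha>) \<le> ereal (2 * \<epsilon>)" if "\<alpha> \<in> A" for \<alpha>
    using that I interval_length_le \<epsilon>(1) by (simp add: vanishes_after_interval_sum_iff)
  then have "(SUP \<alpha>\<in>A. interval_length (I \<alpha>)) \<le> ereal (2 * \<epsilon>)" by (rule SUP_least)
  then have "(SUP \<alpha>\<in>A. interval_length (I \<alpha>)) < \<infinity>" by (rule le_less_trans) simp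
  then show "c \<in> iso_class ` {M \<in> X. \<exists>A I. (\<forall>\<alpha>\<in>A. interval (I \<alpha>)) \<and> isomorphic M (interval_sum A I) \<and>
                          (SUP \<alpha>\<in>A. interval_length (I \<alpha>)) < \<infinity>}"
    using M I iso by blast
next
  have X: "\<forall>N\<in>X. persistence_module N" using assms by (auto simp: cfid_def pfd_def rid_def)
  fix c assume "c \<in> iso_class ` {M \<in> X. \<exists>A I. (\<forall>\<alpha>\<in>A. interval (I \<alpha>)) \<and> isomorphic M (interval_sum A I) \<and>
                          (SUP \<alpha>\<in>A. interval_length (I \<alpha>)) < \<infinity>}"
  then obtain M B J where M: "M \<in> X" "c = iso_class M" and J: "\<forall>\<alpha>\<in>B. interval (J \<alpha>)"
    "isomorphic M (interval_sum B J)" "(SUP \<alpha>\<in>B. interval_length (J \<alpha>)) < \<infinity>"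
    by blast
  note M_pm = bspec[OF X M(1)]
  obtain n :: nat where n: "(SUP \<alpha>\<in>B. interval_length (J \<alpha>)) < ereal (real n)"
    using J(3) less_PInf_Ex_of_nat[of "SUP \<alpha>\<in>B. interval_length (J \<alpha>)"] by auto
  define L where "L = real n"
  have L: "0 \<le> L" "(SUP \<alpha>\<in>B. interval_length (J \<alpha>)) < ereal L"
    using n by (simp_all add: L_def)
  have "shrink L (J \<alpha>) = {}" if "\<alpha> \<in> B" for \<alpha>
    using shrink_empty le_less_trans[OF SUP_upper[OF that] L(2)] by blast
  \<comment> \<open>The bound on the lengths is passed through the vanishing of long maps to a decomposition
    \<open>(A, I)\<close> that stays inside \<open>X\<close> when shrunk.\<close>
  then have vanB: "vanishes_after L (interval_sum B J :: 'k pmod)"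
    by (simp add: vanishes_after_interval_sum_iff)
  obtain A I where I: "\<forall>\<alpha>\<in>A. interval (I \<alpha>)" and iso: "isomorphic M (interval_sum A I)"
    and count: "X = cfid \<longrightarrow> countable A"
    using interval_decomposition[OF assms M(1)] by blast
  have I_int: "is_interval (I \<alpha>)" if "\<alpha> \<in> A" for \<alpha> using I that by (simp add: interval_def)
  have "persistence_module (interval_sum B J :: 'k pmod)"
    using J(1) by (intro persistence_module_interval_sum) (simp add: interval_def)
  moreover have "isomorphic (interval_sum B J) (interval_sum A I :: 'k pmod)"
    using isomorphic_trans[OF isomorphic_sym[OF M_pm J(2)] iso] .
  ultimately have "vanishes_after L (interval_sum A I :: 'k pmod)"
    using vanishes_after_isomorphic vanB L(1) by blast
  then have short: "\<And>\<alpha>. \<alpha> \<in> A \<Longrightarrow> shrink L (I \<alpha>) = {}"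
    by (simp add: vanishes_after_interval_sum_iff)
  define N :: "real \<Rightarrow> 'k pmod" where "N \<tau> = interval_sum A (\<lambda>\<alpha>. shrink (L * \<tau>) (I \<alpha>))" for \<tau>
  have "path_component_of (interleaving_topology X) (iso_class (N 0)) (iso_class (N 1))"
  proof (rule path_of_Lipschitz[OF X L(1)])
    show "N \<tau> \<in> X" for \<tau>
      unfolding N_def by (rule shrink_mem[OF assms M(1) bspec[OF I] iso mp[OF count] short L(1)])
    show "interleaved (L * (\<tau> - \<sigma>)) (N \<sigma>) (N \<tau>)" if "0 \<le> \<sigma>" "\<sigma> \<le> \<tau>" for \<sigma> \<tau>
      using shrink_interleaved[where A = A and s = "L * \<sigma>" and t = "L * \<tau>", OF I_int] that L(1)
      by (simp add: N_def right_diff_distrib mult_left_mono)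
  qed
  moreover have "iso_class (N 0) = c"
  proof -
    have N0: "N 0 = interval_sum A I" by (simp add: N_def)
    have "persistence_module (N 0)" unfolding N0 using I_int by (rule persistence_module_interval_sum)
    then show ?thesis using iso iso_class_eq_iff[OF M_pm] M(2) N0 by metis
  qed
  moreover have "iso_class (N 1) = iso_class zero_module"
  proof -
    have "isomorphic zero_module (N 1)"
      unfolding N_def using short by (intro zero_module_isomorphic) simp
    moreover have "persistence_module (N 1)"
      unfolding N_def using I_int by (intro persistence_module_interval_sum is_interval_shrink)
    ultimately show ?thesis using iso_class_eq_iff[OF persistence_module_zero] by blast
  qed
  ultimately show "c \<in> path_component_of_set (interleaving_topology X) (iso_class zero_module)"
    using path_component_of_sym by force
qed

end
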